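(* Let $p\ge 1$ be an integer and let $R=P/Q$, where $P,Q$ are co-prime polynomials in one variable with constant complex coefficients. Suppose that the autonomous Schwarzian differential equation $$S(f,z)^p=R(f)\qquad(\ast)$$ admits a locally injective transcendental meromorphic solution on $\mathbb{C}$. Then there are a Möbius transformation $\gamma_1$ and a constant $c\in\mathbb{C}\setminus\{0\}$ such that, under the substitution $f=\gamma_1(u)$, equation $(\ast)$ reduces to $$S(u,z)=c,$$ and all (nonconstant meromorphic) solutions of $(\ast)$ are exactly the functions $f(z)=\gamma(e^{\alpha z})$, where $\alpha=\sqrt{-2c}$ and $\gamma$ is any Möbius transformation. Here, in the formula for the solutions, $c$ may be replaced by any complex number with the same $p$-th power $c^p$, and either square root may be used.
   Context: For a nonconstant meromorphic function $f$, the Schwarzian derivative is $S(f,z)=\left(\frac{f''}{f'}\right)'-\frac12\left(\frac{f''}{f'}\right)^2=\frac{f'''}{f'}-\frac32\left(\frac{f''}{f'}\right)^2$. "Meromorphic" means meromorphic in the whole plane $\mathbb{C}$; "transcendental" means not a rational function. A meromorphic function is locally injective if every point of $\mathbb{C}$ has a neighbourhood on which it is injective as a map to $\hat{\mathbb{C}}=\mathbb{C}\cup\{\infty\}$. Since $S(\gamma\circ u,z)=S(u,z)$ for every Möbius transformation $\gamma$, the substitution $f=\gamma(u)$ turns $(\ast)$ into $S(u,z)^p=R(\gamma(u))$. For a rational function $r$, "$(\ast)$ reduces to $S(u,z)=r(u)$ under $f=\gamma(u)$" means that $R(\gamma(w))=r(w)^p$ as rational functions of $w$; thus only $c^p$ is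 determined by $(\ast)$. *)

theory Defs
  imports "HOL-Complex_Analysis.Complex_Analysis" "HOL-Computational_Algebra.Polynomial"
begin

text \<open>
  The Riemann sphere is the one-point extension \<^typ>\<open>complex option\<close>, with \<^term>\<open>None\<close> as the
  point at infinity.

  A meromorphic function on the plane is a function \<^term>\<open>f :: complex \<Rightarrow> complex\<close> with
  \<^prop>\<open>f nicely_meromorphic_on UNIV\<close>; this normalises the values (no removable singularities,
  value 0 at poles), so that each meromorphic function has exactly one representative. The map to
  the sphere that it stands for is \<open>to_sphere f\<close>.
\<close>

definition to_sphere :: "(complex \<Rightarrow> complex) \<Rightarrow> complex \<Rightarrow> complex option" where
  "to_sphere f z = (if is_pole f z then None else Some (f z))"

definition locally_injective :: "(complex \<Rightarrow> complex) \<Rightarrow> bool" where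
  "locally_injective f \<longleftrightarrow> (\<forall>z. \<exists>U. open U \<and> z \<in> U \<and> inj_on (to_sphere f) U)"

definition moebius :: "complex \<Rightarrow> complex \<Rightarrow> complex \<Rightarrow> complex \<Rightarrow> complex option \<Rightarrow> complex option" where
  "moebius a b c d w = (case w of
      None \<Rightarrow> if c = 0 then None else Some (a / c)
    | Some z \<Rightarrow> if c * z + d = 0 then None else Some ((a * z + b) / (c * z + d)))"

definition is_moebius :: "(complex option \<Rightarrow> complex option) \<Rightarrow> bool" where
  "is_moebius \<gamma> \<longleftrightarrow> (\<exists>a b c d. a * d - b * c \<noteq> 0 \<and> \<gamma> = moebius a b c d)"

text \<open>
  The self-map of the sphere given by the rational function \<open>A / B\<close>; meaningful only for coprime
  \<open>A\<close>, \<open>B\<close> with \<open>B \<noteq> 0\<close>. Two rational functions are equal iff these maps are. The value at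
  infinity is the limit: if \<open>degree A < degree B\<close>, then \<^term>\<open>coeff A (degree B)\<close> is 0.
\<close>

definition rat_map :: "complex poly \<Rightarrow> complex poly \<Rightarrow> complex option \<Rightarrow> complex option" where
  "rat_map A B w = (case w of
      None \<Rightarrow> if degree B < degree A then None else Some (coeff A (degree B) / lead_coeff B)
    | Some z \<Rightarrow> if poly B z = 0 then None else Some (poly A z / poly B z))"

definition transcendental :: "(complex \<Rightarrow> complex) \<Rightarrow> bool" where
  "transcendental f \<longleftrightarrow>
     \<not> (\<exists>A B. B \<noteq> 0 \<and> coprime A B \<and> (\<forall>z. to_sphere f z = rat_map A B (Some z)))"

definition schwarzian :: "(complex \<Rightarrow> complex) \<Rightarrow> complex \<Rightarrow> complex" where
  "schwarzian f z =
     (deriv ^^ 3) f z / deriv f z - 3 / 2 * ((deriv ^^ 2) f z / deriv f z)\<^sup>2"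

text \<open>
  The equation \<open>S(f,z)^p = P(f)/Q(f)\<close> is an identity between meromorphic functions, i.e. it holds
  outside a closed discrete set. This set absorbs the poles of \<open>f\<close> and the zeros of \<open>f'\<close> and of
  \<open>Q(f)\<close>, where the terms below carry default values.
\<close>

definition schwarzian_solution ::
    "nat \<Rightarrow> complex poly \<Rightarrow> complex poly \<Rightarrow> (complex \<Rightarrow> complex) \<Rightarrow> bool" where
  "schwarzian_solution p P Q f \<longleftrightarrow>
     f nicely_meromorphic_on UNIV \<and> \<not> f constant_on UNIV \<and>
     (\<forall>\<^sub>\<approx>z. schwarzian f z ^ p = poly P (f z) / poly Q (f z))"

text \<open>
  With \<open>R = P/Q\<close> and \<open>r = A/B\<close> in lowest terms, \<open>S(f,z)^p = R(f)\<close> reduces to \<open>S(u,z) = r(u)\<close> under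
  \<open>f = \<gamma>(u)\<close> iff \<open>R(\<gamma>(w)) = r(w)^p\<close> as rational functions of \<open>w\<close>.
\<close>

definition reduces_to ::
    "nat \<Rightarrow> complex poly \<Rightarrow> complex poly \<Rightarrow> (complex option \<Rightarrow> complex option) \<Rightarrow>
     complex poly \<Rightarrow> complex poly \<Rightarrow> bool" where
  "reduces_to p P Q \<gamma> A B \<longleftrightarrow> rat_map P Q \<circ> \<gamma> = rat_map (A ^ p) (B ^ p)"

end

theory Submission
  imports Defs "HOL-Computational_Algebra.Fundamental_Theorem_Algebra"
begin

text \<open>
  Write \<open>S(f)\<close> for the Schwarzian derivative and \<open>R = P/Q\<close>. The theorem has two halves: the
  existence of a locally injective solution forces \<open>R\<close> to be constant, and the equation
  \<open>S(f) = c\<close> is solved explicitly.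

  For the first half, suppose that \<open>R\<close> has a pole \<open>w\<^sub>0\<close> on the sphere. Local injectivity makes
  \<open>S(f)\<close> finite everywhere, also at the poles of \<open>f\<close>, because the Schwarzian does not change when a
  Moebius map is applied to \<open>f\<close>. Since \<open>R(f) = S(f)^p\<close>, the solution never takes the value \<open>w\<^sub>0\<close>.
  Moving \<open>w\<^sub>0\<close> to infinity by a Moebius map gives an entire function \<open>F\<close> with zero-free derivative
  \<open>F' = e^g\<close>, and the pole of \<open>R\<close> gives \<open>|F| \<le> K |S(F)|^p\<close> wherever \<open>|F|\<close> is large. But
  \<open>S(F) = g'' - g'^2/2\<close>, and \<open>Re g = log |F'|\<close> is controlled by the logarithm of the maximum modulus
  of \<open>F\<close>. The Borel-Caratheodory inequality therefore bounds \<open>S(F)\<close> by a power of the logarithm of the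
  maximum modulus on a slightly larger disc. A function whose maximum modulus is bounded by a power
  of its own logarithm in this sense has polynomial growth: otherwise the maximum modulus would become
  infinite within a bounded distance. So \<open>F\<close> is a polynomial with zero-free derivative,
  hence affine, hence \<open>S(F) = 0\<close>, which contradicts \<open>|F| \<le> K |S(F)|^p\<close>. This is
  \<open>entire_locally_univalent_not_dominated_by_schwarzian\<close>, which replaces the lemma on the logarithmic
  derivative from Nevanlinna theory.

  For the second half, \<open>S(f)^p\<close> constant makes \<open>S(f)\<close> locally equal to a constant \<open>c\<close>. Two functions
  with equal Schwarzian are Moebius images of each other (\<open>schwarzian_eq_imp_moebius\<close>), and
  \<open>e^{\<alpha>z}\<close> has Schwarzian \<open>-\<alpha>\<^sup>2/2\<close>, so \<open>f = \<gamma>(e^{\<alpha>z})\<close> on a disc and then everywhere by the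
  identity theorem. The constant is nonzero for the given solution since the Moebius images of \<open>z\<close>
  itself are rational.
\<close>

section \<open>Maximum modulus and the Schwarzian of an entire function\<close>

text \<open>
  The Borel-Caratheodory inequality: \<open>w \<mapsto> w / (2A - w)\<close> maps the half-plane \<open>Re w < A\<close> to the unit disc
  and fixes 0, so the Schwarz lemma applies to the rescaled composition with \<open>g\<close>.
\<close>

lemma Borel_Caratheodory:
  assumes g: "g holomorphic_on ball 0 R" "g 0 = 0"
    and A: "\<And>z. z \<in> ball 0 R \<Longrightarrow> Re (g z) < A"
    and z: "z \<in> ball 0 R"
  shows "norm (g z) \<le> 2 * A * norm z / (R - norm z)"
proof -
  have R: "R > 0" "norm z < R"
    using z by (auto intro: le_less_trans[OF norm_ge_zero])
  have "A > 0"
    using A[of 0] g(2) R by simp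
  have less: "norm (g w) < norm (2 * A - g w)" if "w \<in> ball 0 R" for w
  proof -
    have "norm (2 * A - g w) ^ 2 - norm (g w) ^ 2 = 4 * A * (A - Re (g w))"
      by (simp only: cmod_power2) (simp add: power2_eq_square algebra_simps)
    also have "\<dots> > 0"
      using A[OF that] \<open>A > 0\<close> by simp
    finally show ?thesis
      by (simp add: power2_less_imp_less)
  qed
  define h where "h = (\<lambda>w::complex. g (R * w) / (2 * A - g (R * w)))"
  have in_ball: "R * w \<in> ball 0 R" if "w \<in> ball 0 1" for w :: complex
    using that R by (simp add: norm_mult)
  have "norm (h (z / R)) \<le> norm (z / R)"
  proof (rule Schwarz_Lemma(1))
    have "(\<lambda>w. g (R * w)) holomorphic_on ball 0 1"
      using holomorphic_on_compose_gen[OF _ g(1), of "\<lambda>w. R * w" "ball 0 1"] in_ball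
      unfolding o_def by (simp add: image_subset_iff holomorphic_on_mult)
    then show "h holomorphic_on ball 0 1"
      unfolding h_def using less[OF in_ball] by (intro holomorphic_intros) force+
    show "norm (h w) < 1" if "norm w < 1" for w
      using less[OF in_ball, of w] that
      by (auto simp: h_def norm_divide divide_less_eq_1)
  qed (use R g in \<open>auto simp: h_def norm_divide\<close>)
  moreover have "norm (h (z / R)) = norm (g z) / norm (2 * A - g z)"
    using R by (simp add: h_def norm_divide)
  ultimately have "norm (g z) / norm (2 * A - g z) \<le> norm z / R"
    using R by (simp add: norm_divide)
  then have "norm (g z) * R \<le> norm z * norm (2 * A - g z)"
    using le_less_trans[OF norm_ge_zero less[OF z]] R by (simp add: field_simps)
  also have "\<dots> \<le> norm z * (2 * A + norm (g z))"
    using norm_triangle_ineq4[of "2 * A" "g z"] \<open>A > 0\<close> by (intro mult_left_mono) (simp_all add: norm_mult)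
  finally show ?thesis
    using R by (simp add: field_simps)
qed

text \<open>
  The Borel growth lemma in the form needed here. If \<open>exp (L r\<^sub>0 / (2q))\<close> beats a large multiple of \<open>r\<^sub>0\<close>
  for one radius \<open>r\<^sub>0\<close>, then the hypothesis, used repeatedly with \<open>\<delta> = 1, 1/2, 1/4, \<dots>\<close>, makes \<open>L\<close> grow
  at each step by at least \<open>4q\<close>, although all radii stay below \<open>r\<^sub>0 + 2\<close>. The loss from \<open>\<delta> ^ 3\<close> is
  geometric and is absorbed by the exponential on the left.
\<close>

lemma exp_growth_imp_log_bound:
  fixes L :: "real \<Rightarrow> real" and q C :: real
  assumes mono: "\<And>r s. 1 \<le> r \<Longrightarrow> r \<le> s \<Longrightarrow> L r \<le> L s"
    and pos: "q > 0" "C > 0"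
    and growth: "\<And>r \<delta>. 1 \<le> r \<Longrightarrow> 0 < \<delta> \<Longrightarrow> \<delta> \<le> 1 \<Longrightarrow> exp (L r / q) \<le> C * r * L (r + \<delta>) / \<delta> ^ 3"
  shows "\<exists>K. \<forall>r\<ge>1. exp (L r / (2 * q)) \<le> K * r"
proof (rule ccontr)
  \<comment> \<open>The factor 12 is 4 from the step size \<open>4 * q\<close> times 3 from \<open>r0 + 2 \<le> 3 * r0\<close>.\<close>
  define K where "K = 12 * q * C + 1"
  have K: "K \<ge> 1" "K \<ge> 12 * q * C"
    using pos by (auto simp: K_def)
  assume "\<not> ?thesis"
  then obtain r0 where r0: "r0 \<ge> 1" "exp (L r0 / (2 * q)) > K * r0"
    by (meson not_le)
  define X where "X = L r0"
  have "1 \<le> K * r0"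
    using mult_mono[of 1 K 1 r0] K r0(1) by simp
  then have "exp (X / (2 * q)) > 1"
    using r0(2) unfolding X_def by linarith
  then have X: "X > 0"
    using pos by (simp only: one_less_exp_iff) (simp add: zero_less_divide_iff)
  have "X + 4 * q \<le> 4 * q * (1 + X / (2 * q))"
    using X pos by (simp add: field_simps)
  also have "\<dots> \<le> 4 * q * exp (X / (2 * q))"
    using pos by (intro mult_left_mono exp_ge_add_one_self) auto
  finally have "(X + 4 * q) * (3 * C * r0) \<le> 4 * q * exp (X / (2 * q)) * (3 * C * r0)"
    using pos r0(1) by (intro mult_right_mono) auto
  also have "\<dots> = exp (X / (2 * q)) * (12 * q * C * r0)"
    by simp
  also have "\<dots> \<le> exp (X / (2 * q)) * (K * r0)"
    using K r0(1) by (intro mult_left_mono mult_right_mono) auto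
  also have "\<dots> \<le> exp (X / (2 * q)) * exp (X / (2 * q))"
    using r0(2) by (intro mult_left_mono) (auto simp: X_def)
  also have "\<dots> = exp (X / q)"
    by (simp flip: exp_add)
  finally have start: "(X + 4 * q) * (3 * C * r0) \<le> exp (X / q)" .

  define r where "r = (\<lambda>n::nat. r0 + (\<Sum>k<n. (1 / 2) ^ k))"
  have "(\<Sum>k<n. (1 / 2 :: real) ^ k) = 2 - 2 * (1 / 2) ^ n" for n
    by (induction n) (auto simp: field_simps)
  then have r: "r0 \<le> r n" "r n \<le> r0 + 2" for n
    by (auto simp: r_def sum_nonneg power_le_one simp del: sum.lessThan_Suc)
  have lower: "L (r n) \<ge> X + 4 * q * n" for n
  proof (induction n)
    case 0
    then show ?case by (simp add: r_def X_def)
  next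
    case (Suc n)
    have r_Suc: "r (Suc n) = r n + (1 / 2) ^ n"
      by (simp add: r_def)
    have r_pos: "r n > 0" "r n \<le> 3 * r0"
      using r[of n] r0(1) by linarith+
    have "exp (L (r n) / q) \<le> C * r n * L (r n + (1 / 2) ^ n) / ((1 / 2) ^ n) ^ 3"
      using r[of n] r0(1) by (intro growth) (auto simp: power_le_one)
    also have "\<dots> = C * r n * L (r (Suc n)) * 8 ^ n"
      by (simp add: r_Suc power_divide power_commutes flip: power_mult)
         (simp add: mult.commute[of n] power_mult)
    finally have up: "exp (L (r n) / q) \<le> C * r n * L (r (Suc n)) * 8 ^ n" .
    have "0 < C * r n * L (r (Suc n)) * 8 ^ n"
      by (rule less_le_trans[OF exp_gt_zero up])
    then have l_pos: "L (r (Suc n)) > 0"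
      using mult_pos_pos[OF pos(2) r_pos(1)] by (auto simp: zero_less_mult_iff)
    \<comment> \<open>Each step of size \<open>4 * q\<close> gains a factor \<open>exp 4 \<ge> 16\<close> on the left and loses only a factor 8 to
      the shrinking of \<open>\<delta>\<close>.\<close>
    have e: "(16::real) \<le> exp 4"
    proof -
      have "(2::real) ^ 4 \<le> exp 1 ^ 4"
        using exp_ge_add_one_self[of 1] by (intro power_mono) auto
      then show ?thesis
        by (simp flip: exp_of_nat_mult)
    qed
    have "(X + 4 * q) * (3 * C * r0) * 16 ^ n \<le> exp (X / q) * exp 4 ^ n"
      using start e by (intro mult_mono power_mono) auto
    also have "\<dots> = exp ((X + 4 * q * n) / q)"
      using pos by (simp add: add_divide_distrib exp_add exp_of_nat_mult mult.commute)
    also have "\<dots> \<le> exp (L (r n) / q)"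
      using Suc.IH pos by (simp add: divide_right_mono)
    also note up
    also have "C * r n * L (r (Suc n)) * 8 ^ n \<le> C * (3 * r0) * L (r (Suc n)) * 8 ^ n"
      using r_pos l_pos pos by (intro mult_right_mono mult_left_mono) auto
    finally have "(X + 4 * q) * 16 ^ n * (3 * C * r0) \<le> L (r (Suc n)) * 8 ^ n * (3 * C * r0)"
      by (simp only: mult_ac)
    then have "(X + 4 * q) * 16 ^ n \<le> L (r (Suc n)) * 8 ^ n"
      using pos r0(1) by (subst (asm) mult_le_cancel_right) auto
    moreover have "(16::real) ^ n = 2 ^ n * 8 ^ n"
      by (simp flip: power_mult_distrib)
    ultimately have "(X + 4 * q) * 2 ^ n \<le> L (r (Suc n))"
      by simp
    moreover have "real (Suc n) \<le> 2 ^ n"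
      by (induction n) auto
    then have "(X + 4 * q) * real (Suc n) \<le> (X + 4 * q) * 2 ^ n"
      using X pos by (intro mult_left_mono) auto
    moreover have "X + 4 * q * real (Suc n) \<le> (X + 4 * q) * real (Suc n)"
      using X by (simp add: algebra_simps)
    ultimately show ?case
      by linarith
  qed
  obtain n :: nat where "(L (r0 + 2) - X) / (4 * q) < n"
    using reals_Archimedean2 by blast
  then have "L (r0 + 2) < X + 4 * q * n"
    using pos by (simp add: field_simps)
  also have "\<dots> \<le> L (r n)"
    by (rule lower)
  also have "\<dots> \<le> L (r0 + 2)"
    using r[of n] r0(1) by (intro mono) auto
  finally show False
    by simp
qed

lemma schwarzian_exp_derivative:
  assumes "open U" "g holomorphic_on U" "\<And>w. w \<in> U \<Longrightarrow> deriv f w = exp (g w)" "z \<in> U"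
  shows "schwarzian f z = (deriv ^^ 2) g z - (deriv g z)\<^sup>2 / 2"
proof -
  have ev: "\<forall>\<^sub>F v in nhds w. v \<in> U" if "w \<in> U" for w
    using assms(1) that by (rule eventually_nhds_in_open)
  have D1: "deriv (deriv f) w = deriv g w * exp (g w)" if w: "w \<in> U" for w
  proof -
    have "((\<lambda>v. exp (g v)) has_field_derivative deriv g w * exp (g w)) (at w)"
      using holomorphic_derivI[OF assms(2,1) w]
      by (rule DERIV_chain2[OF DERIV_exp, THEN DERIV_cong]) (simp add: mult.commute)
    moreover have "deriv (deriv f) w = deriv (\<lambda>v. exp (g v)) w"
      using ev[OF w] by (intro deriv_cong_ev) (auto elim!: eventually_mono simp: assms(3))
    ultimately show ?thesis
      by (simp add: DERIV_imp_deriv)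
  qed
  have "(deriv ^^ 3) f z = deriv (deriv (deriv f)) z"
    by (simp add: numeral_3_eq_3)
  also have "\<dots> = deriv (\<lambda>w. deriv g w * exp (g w)) z"
    using ev[OF assms(4)] by (intro deriv_cong_ev) (auto elim!: eventually_mono simp: D1)
  also have "\<dots> = deriv (deriv g) z * exp (g z) + deriv g z * (deriv g z * exp (g z))"
  proof (rule DERIV_imp_deriv)
    note [derivative_intros] = holomorphic_derivI[OF assms(2,1,4), THEN DERIV_chain2[OF DERIV_exp]]
      holomorphic_derivI[OF holomorphic_deriv[OF assms(2,1)] assms(1,4)]
    show "((\<lambda>w. deriv g w * exp (g w)) has_field_derivative
        deriv (deriv g) z * exp (g z) + deriv g z * (deriv g z * exp (g z))) (at z)"
      by (rule derivative_eq_intros refl)+ (simp add: algebra_simps)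
  qed
  finally have D2: "(deriv ^^ 3) f z = deriv (deriv g) z * exp (g z) + deriv g z * (deriv g z * exp (g z))" .
  show ?thesis
    using D1[OF assms(4)] assms(3)[OF assms(4)]
    by (simp add: schwarzian_def D2 numeral_2_eq_2 power2_eq_square field_simps)
qed

text \<open>
  The distance \<open>3d\<close> between the circle of radius \<open>r\<close> and the disc on which \<open>F\<close> is bounded is spent in
  three equal parts: Cauchy's inequality from \<open>F\<close> to \<open>F' = exp g\<close>, Borel-Caratheodory from \<open>Re g\<close> to
  \<open>g - g 0\<close>, and Cauchy's inequality from there to \<open>g'\<close> and \<open>g''\<close>.
\<close>

lemma norm_schwarzian_le_log_growth:
  assumes F: "F holomorphic_on UNIV" and g: "g holomorphic_on UNIV" "\<And>w. deriv F w = exp (g w)"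
    and r: "r \<ge> 1" and d: "0 < d" "d \<le> 1"
    and M: "M \<ge> 1" "\<And>w. norm w \<le> r + 3 * d \<Longrightarrow> norm (F w) \<le> M"
    and z: "norm z \<le> r"
  shows "norm (schwarzian F z) \<le> (4 * r * (ln M + norm (g 0) + 2) / d ^ 3)\<^sup>2"
proof -
  define A where "A = ln M + 1 / d + norm (g 0) + 1"
  define B where "B = 4 * A * r / d"
  have hol: "f holomorphic_on X" "continuous_on X f" if "f holomorphic_on UNIV" for f X
    using that holomorphic_on_subset holomorphic_on_imp_continuous_on by blast+
  have "ln M \<ge> 0" "1 / d \<ge> 1" "norm (g 0) \<ge> 0"
    using d M(1) by (auto simp: field_simps)
  then have A: "A \<ge> 2"
    unfolding A_def by linarith
  have B: "B \<ge> 4"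
  proof -
    have "4 * d \<le> 4 * A * r"
      using A r d by (intro order_trans[OF _ mult_mono[of 4 "4 * A" 1 r]]) auto
    then show ?thesis using d by (simp add: B_def field_simps)
  qed
  have Re_g: "Re (g w) \<le> ln M + 1 / d" if w: "norm w \<le> r + 2 * d" for w
  proof -
    have "norm ((deriv ^^ 1) F w) \<le> fact 1 * M / d ^ 1"
    proof (rule Cauchy_inequality)
      fix x assume "norm (w - x) = d"
      then show "norm (F x) \<le> M"
        using w norm_triangle_ineq2[of x w] by (intro M(2)) (simp add: norm_minus_commute)
    qed (use hol[OF F] d in auto)
    then have "exp (Re (g w)) \<le> M / d"
      using g(2) by simp
    then have "Re (g w) \<le> ln (M / d)"
      by (subst ln_ge_iff) (use M d in auto)
    also have "\<dots> = ln M + ln (1 / d)"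
      using M d by (simp add: ln_div)
    also have "ln (1 / d) \<le> 1 / d"
      using d ln_add_one_self_le_self2[of "1 / d - 1"] by simp
    finally show ?thesis by simp
  qed
  have g_bound: "norm (g w - g 0) \<le> B" if w: "norm w \<le> r + d" for w
  proof -
    have "norm (g w - g 0) \<le> 2 * A * norm w / (r + 2 * d - norm w)"
    proof (rule Borel_Caratheodory)
      fix v :: complex assume "v \<in> ball 0 (r + 2 * d)"
      then have "Re (g v) \<le> ln M + 1 / d"
        by (intro Re_g) auto
      then show "Re (g v - g 0) < A"
        using complex_Re_le_cmod[of "- g 0"] by (simp add: A_def)
    qed (use hol[OF g(1)] w d in \<open>auto intro!: holomorphic_intros\<close>)
    also have "\<dots> \<le> 2 * A * (2 * r) / d"
      using A r d w by (intro frac_le mult_mono) auto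
    finally show ?thesis by (simp add: B_def)
  qed
  have deriv_bound: "norm ((deriv ^^ n) (\<lambda>w. g w - g 0) z) \<le> fact n * B / d ^ n" for n
  proof (rule Cauchy_inequality)
    fix x assume "norm (z - x) = d"
    then show "norm (g x - g 0) \<le> B"
      using z norm_triangle_ineq2[of x z] by (intro g_bound) (simp add: norm_minus_commute)
  qed (use hol[OF g(1)] d in \<open>auto intro!: holomorphic_intros continuous_intros\<close>)
  have higher: "(deriv ^^ n) (\<lambda>w. g w - g 0) z = (deriv ^^ n) g z" if "n > 0" for n
    using that g(1) by (subst higher_deriv_diff[of _ UNIV]) auto
  have "norm (schwarzian F z) = norm ((deriv ^^ 2) g z - (deriv g z)\<^sup>2 / 2)"
    using g by (subst schwarzian_exp_derivative[of UNIV g]) auto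
  also have "\<dots> \<le> norm ((deriv ^^ 2) g z) + (norm (deriv g z))\<^sup>2 / 2"
    using norm_triangle_ineq4[of "(deriv ^^ 2) g z" "(deriv g z)\<^sup>2 / 2"]
    by (simp add: norm_divide norm_power)
  also have "\<dots> \<le> 2 * B / d ^ 2 + (B / d)\<^sup>2 / 2"
    using deriv_bound[of 2] deriv_bound[of 1] higher[of 2] higher[of 1]
    by (intro add_mono divide_right_mono power_mono) auto
  also have "\<dots> = (2 * B + B\<^sup>2 / 2) / d\<^sup>2"
    by (simp add: add_divide_distrib power_divide)
  also have "\<dots> \<le> B\<^sup>2 / d\<^sup>2"
    using B d mult_right_mono[of 4 B B]
    by (intro divide_right_mono) (auto simp: power2_eq_square field_simps)
  also have "\<dots> = (B / d)\<^sup>2"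
    by (simp add: power_divide)
  also have "\<dots> \<le> (4 * r * (ln M + norm (g 0) + 2) / d ^ 3)\<^sup>2"
  proof (rule power_mono)
    have "d * x \<le> x" if "x \<ge> 0" for x
      using d that by (simp add: mult_left_le_one_le)
    from this[of "ln M + norm (g 0) + 1"] have "A * d \<le> ln M + norm (g 0) + 2"
      using d M by (simp add: A_def algebra_simps)
    then have "4 * r * (A * d) / d ^ 3 \<le> 4 * r * (ln M + norm (g 0) + 2) / d ^ 3"
      using r d by (intro divide_right_mono mult_left_mono) auto
    then show "B / d \<le> 4 * r * (ln M + norm (g 0) + 2) / d ^ 3"
      using d by (simp add: B_def field_simps power3_eq_cube)
  qed (use B d in auto)
  finally show ?thesis .
qed


text \<open>
  By Liouville such a function is a polynomial, and its derivative is a polynomial without zeros.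
\<close>

lemma entire_polynomial_growth_deriv_nonzero:
  assumes F: "F holomorphic_on UNIV" and F': "\<And>z. deriv F z \<noteq> 0"
    and bound: "\<And>z::complex. norm z \<ge> 1 \<Longrightarrow> norm (F z) \<le> B * norm z ^ n"
  shows "\<exists>k. deriv F = (\<lambda>_. k)"
proof -
  define P where "P = (\<Sum>k\<le>n. monom ((deriv ^^ k) F 0 / fact k) k)"
  have "F z = poly P z" for z :: complex
    using Liouville_polynomial[OF F bound, where \<xi> = z] by (simp add: P_def poly_sum poly_monom)
  then have FP: "F = poly P"
    by blast
  have dF: "deriv F = poly (pderiv P)"
    unfolding FP by (intro ext DERIV_imp_deriv poly_DERIV)
  have "constant (poly (pderiv P))"
    using Fundamental_Theorem_Algebra.fundamental_theorem_of_algebra[of "pderiv P"] F' dF by metis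
  then show ?thesis
    unfolding dF constant_def by (metis ext)
qed

text \<open>
  At a point where \<open>|F|\<close> attains its maximum \<open>M r\<close> on the disc of radius \<open>r\<close>, the domination hypothesis
  and \<open>norm_schwarzian_le_log_growth\<close> bound \<open>M r\<close> by a power of \<open>r * ln (M (r + \<delta>)) / \<delta>^3\<close>. The growth
  lemma turns this into polynomial growth, so \<open>F\<close> is affine and its Schwarzian vanishes.
\<close>

theorem entire_locally_univalent_not_dominated_by_schwarzian:
  assumes F: "F holomorphic_on UNIV" and F': "\<And>z. deriv F z \<noteq> 0" and p: "p \<ge> 1"
    and dom: "\<And>z. norm (F z) > C \<Longrightarrow> norm (F z) \<le> K * norm (schwarzian F z) ^ p"
  shows False
proof -
  have [simp]: "continuous_on X F" for X
    using F holomorphic_on_subset holomorphic_on_imp_continuous_on by blast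
  obtain g where g: "g holomorphic_on UNIV" "\<And>w. exp (g w) = deriv F w"
    using holomorphic_logarithm_exists[of UNIV "deriv F" 0] F' holomorphic_deriv[OF F]
    by auto
  define M where "M = (\<lambda>r. SUP z\<in>cball 0 r. norm (F z))"
  have le_M: "norm (F z) \<le> M r" if "norm z \<le> r" for z r
    unfolding M_def using that
    by (intro cSUP_upper compact_imp_bounded[THEN bounded_imp_bdd_above] compact_continuous_image
        continuous_intros) auto
  have M_attained: "\<exists>z. norm z \<le> r \<and> norm (F z) = M r" if "r \<ge> 0" for r
  proof -
    obtain z where z: "z \<in> cball 0 r" "\<forall>w\<in>cball 0 r. norm (F w) \<le> norm (F z)"
      using continuous_attains_sup[of "cball 0 r" "\<lambda>z. norm (F z)"] \<open>r \<ge> 0\<close>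
      by (auto simp: continuous_on_norm)
    then have "M r \<le> norm (F z)"
      unfolding M_def using that by (intro cSUP_least) auto
    then show ?thesis
      using le_M[of z r] z(1) by auto
  qed
  \<comment> \<open>Cutting \<open>M\<close> off from below by \<open>m\<close> keeps the logarithm nonnegative and covers the radii at
    which the domination hypothesis says nothing.\<close>
  define m where "m = max 1 C"
  define c where "c = norm (g 0) + 2"
  define N where "N = (\<lambda>r. max m (M r))"
  define L where "L = (\<lambda>r. ln (N r) + c)"
  define q where "q = real (2 * p)"
  have c: "c \<ge> 2"
    by (simp add: c_def)
  have N: "N r \<ge> 1" "N r \<ge> m" for r
    by (auto simp: N_def m_def)
  then have L: "L r \<ge> 2" for r
    using c by (simp add: L_def add_increasing)
  have q: "q \<ge> 1"
    using p by (simp add: q_def)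
  have N_mono: "N r \<le> N s" if "1 \<le> r" "r \<le> s" for r s
  proof -
    obtain z where "norm z \<le> r" "norm (F z) = M r"
      using M_attained[of r] \<open>1 \<le> r\<close> by auto
    then have "M r \<le> M s"
      using le_M[of z s] that by simp
    then show ?thesis
      by (auto simp: N_def)
  qed
  define K1 where "K1 = max 1 K"
  define C1 where "C1 = exp c * (108 * K1 + m)"
  have K1: "K1 \<ge> 1" "K1 \<ge> K" and m: "m \<ge> 1" "m \<ge> C"
    by (auto simp: K1_def m_def)
  have C1: "C1 > 0"
    unfolding C1_def using K1 m by (intro mult_pos_pos) auto
  have growth: "exp (L r / q) \<le> C1 * r * L (r + \<delta>) / \<delta> ^ 3"
    if r: "1 \<le> r" and \<delta>: "0 < \<delta>" "\<delta> \<le> 1" for r \<delta>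
  proof -
    define T where "T = r * L (r + \<delta>) / \<delta> ^ 3"
    have "\<delta> ^ 3 \<le> 1"
      using \<delta> by (simp add: power_le_one)
    also have "1 \<le> r * L (r + \<delta>)"
      using r L[of "r + \<delta>"] mult_mono[of 1 r 1 "L (r + \<delta>)"] by simp
    finally have T: "T \<ge> 1"
      using \<delta> by (simp add: T_def field_simps)
    have "exp (ln (N r) / q) \<le> (108 * K1 + m) * T"
    proof (cases "M r > m")
      case False
      then have "ln (N r) / q \<le> ln m"
        using q m(1) mult_right_mono[of 1 q "ln m"] by (simp add: N_def max_def field_simps)
      then have "exp (ln (N r) / q) \<le> exp (ln m)"
        by simp
      also have "\<dots> = m * 1"
        using m(1) by simp
      also have "\<dots> \<le> (108 * K1 + m) * T"
        using m K1 T by (intro mult_mono) auto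
      finally show ?thesis .
    next
      case True
      then obtain z where z: "norm z \<le> r" "norm (F z) = N r"
        using M_attained[of r] r by (auto simp: N_def)
      have "norm (schwarzian F z) \<le> (4 * r * (ln (N (r + \<delta>)) + norm (g 0) + 2) / (\<delta> / 3) ^ 3)\<^sup>2"
      proof (rule norm_schwarzian_le_log_growth[OF F g(1) g(2)[symmetric] r _ _ _ _ z(1)])
        show "norm (F w) \<le> N (r + \<delta>)" if "norm w \<le> r + 3 * (\<delta> / 3)" for w
          using le_M[of w "r + \<delta>"] that by (simp add: N_def)
      qed (use \<delta> N in auto)
      also have "\<dots> = (108 * T)\<^sup>2"
        by (simp add: T_def L_def c_def power_divide algebra_simps)
      finally have S: "norm (schwarzian F z) ^ p \<le> (108 * T) ^ (2 * p)"
        using power_mono[of "norm (schwarzian F z)" "(108 * T)\<^sup>2" p] by (simp add: power_mult)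
      have "N r \<le> K * norm (schwarzian F z) ^ p"
        using dom[of z] z True m by (simp add: N_def)
      also have "\<dots> \<le> K1 * (108 * T) ^ (2 * p)"
        using S K1 by (intro mult_mono) auto
      also have "\<dots> \<le> K1 ^ (2 * p) * (108 * T) ^ (2 * p)"
        using K1 p T by (intro mult_right_mono self_le_power) auto
      also have "\<dots> = (108 * K1 * T) ^ (2 * p)"
        by (simp add: power_mult_distrib)
      finally have "ln (N r) \<le> ln ((108 * K1 * T) ^ (2 * p))"
        using N[of r] by (intro ln_mono) auto
      also have "\<dots> = q * ln (108 * K1 * T)"
        using K1 T by (subst ln_realpow) (auto simp: q_def)
      finally have "exp (ln (N r) / q) \<le> exp (ln (108 * K1 * T))"
        using q by (simp add: field_simps)
      also have "\<dots> = 108 * K1 * T"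
        using K1 T by (intro exp_ln) auto
      also have "\<dots> \<le> (108 * K1 + m) * T"
        using T m by (intro mult_right_mono) auto
      finally show ?thesis .
    qed
    moreover have "exp (c / q) \<le> exp c"
      using q c mult_left_mono[of 1 q c] by (simp add: field_simps)
    moreover have "exp (L r / q) = exp (c / q) * exp (ln (N r) / q)"
      by (simp add: L_def add_divide_distrib exp_add mult.commute)
    ultimately have "exp (L r / q) \<le> exp c * ((108 * K1 + m) * T)"
      by (simp only:) (intro mult_mono, auto)
    then show ?thesis
      by (simp add: C1_def T_def mult_ac)
  qed
  have "\<exists>K2. \<forall>r\<ge>1. exp (L r / (2 * q)) \<le> K2 * r"
  proof (rule exp_growth_imp_log_bound[OF _ _ C1 growth])
    show "L r \<le> L s" if "1 \<le> r" "r \<le> s" for r s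
      using N_mono[OF that] N(1)[of r] by (simp add: L_def)
  qed (use q in auto)
  then obtain K2 where K2: "\<And>r. r \<ge> 1 \<Longrightarrow> exp (L r / (2 * q)) \<le> K2 * r"
    by blast
  have "norm (F z) \<le> K2 ^ (4 * p) * norm z ^ (4 * p)" if z: "norm z \<ge> 1" for z
  proof -
    have "norm (F z) \<le> N (norm z)"
      using le_M[of z "norm z"] by (simp add: N_def)
    also have "\<dots> = exp (ln (N (norm z)))"
      using N(1)[of "norm z"] by (intro exp_ln[symmetric]) linarith
    also have "\<dots> \<le> exp (L (norm z))"
      using c by (simp add: L_def)
    also have "\<dots> = exp (L (norm z) / (2 * q)) ^ (4 * p)"
      using p by (simp add: q_def flip: exp_of_nat_mult)
    also have "\<dots> \<le> (K2 * norm z) ^ (4 * p)"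
      using K2[OF z] by (intro power_mono) auto
    finally show ?thesis
      by (simp add: power_mult_distrib)
  qed
  from entire_polynomial_growth_deriv_nonzero[OF F F' this]
  obtain k where k: "deriv F = (\<lambda>_. k)"
    by blast
  have "schwarzian F z = 0" for z
    by (simp add: schwarzian_def k numeral_2_eq_2 numeral_3_eq_3)
  then have "norm (F z) \<le> max C 0" for z
    using dom[of z] p by (cases "norm (F z) > C") (auto simp: power_0_left)
  then have "bounded (range F)"
    by (auto simp: bounded_iff)
  then obtain y where "F = (\<lambda>_. y)"
    using Liouville_theorem[OF F] by (auto simp: constant_on_def)
  then have "deriv F 0 = 0"
    by simp
  then show False
    using F' by blast
qed

section \<open>Moebius maps and the Schwarzian\<close>

text \<open>
  The form \<open>N' - N\<^sup>2/2\<close> with the pre-Schwarzian \<open>N = f''/f'\<close> is the one for which Moebius invariance is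
  a short computation.
\<close>

lemma schwarzian_eq_pre_schwarzian:
  assumes "f analytic_on {z}" "deriv f z \<noteq> 0"
  shows "schwarzian f z =
    deriv (\<lambda>w. deriv (deriv f) w / deriv f w) z - (deriv (deriv f) z / deriv f z)\<^sup>2 / 2"
proof -
  obtain U where U: "open U" "z \<in> U" "f holomorphic_on U"
    using assms(1) by (auto simp: analytic_at)
  have hol: "deriv f holomorphic_on U" "deriv (deriv f) holomorphic_on U"
    using U by (auto intro!: holomorphic_deriv)
  have "deriv (\<lambda>w. deriv (deriv f) w / deriv f w) z
      = (deriv (deriv (deriv f)) z * deriv f z - deriv (deriv f) z * deriv (deriv f) z) / (deriv f z * deriv f z)"
    using assms(2) by (intro DERIV_imp_deriv DERIV_divide holomorphic_derivI[OF _ U(1,2)] hol) auto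
  then show ?thesis
    using assms(2) by (simp only:)
      (simp add: schwarzian_def numeral_2_eq_2 numeral_3_eq_3 field_simps power2_eq_square)
qed

lemma schwarzian_cong:
  assumes "\<forall>\<^sub>F w in nhds z. f w = g w"
  shows "schwarzian f z = schwarzian g z"
  using higher_deriv_cong_ev[OF assms refl] deriv_cong_ev[OF assms refl]
  by (simp add: schwarzian_def)

lemma schwarzian_analytic:
  assumes "f analytic_on {z}" "deriv f z \<noteq> 0"
  shows "schwarzian f analytic_on {z}"
  unfolding schwarzian_def[abs_def] using assms by (auto intro!: analytic_intros)

text \<open>
  Composition with a Moebius map changes the pre-Schwarzian \<open>N = f''/f'\<close> to \<open>N - 2cf'/(cf + d)\<close>, and
  the two contributions of the correction to \<open>N' - N\<^sup>2/2\<close> cancel.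
\<close>

lemma schwarzian_moebius_compose:
  fixes f :: "complex \<Rightarrow> complex"
  assumes f: "f analytic_on {z}" "deriv f z \<noteq> 0" and nz: "c * f z + d \<noteq> 0" and det: "a * d - b * c \<noteq> 0"
  defines "g \<equiv> \<lambda>w. (a * f w + b) / (c * f w + d)"
  shows "g analytic_on {z}" "deriv g z \<noteq> 0" "schwarzian g z = schwarzian f z"
proof -
  obtain V where V: "open V" "z \<in> V" "f holomorphic_on V"
    using f(1) by (auto simp: analytic_at)
  have cont: "continuous_on V (deriv f)" "continuous_on V (\<lambda>w. c * f w + d)"
    using holomorphic_on_imp_continuous_on[OF V(3)]
      holomorphic_on_imp_continuous_on[OF holomorphic_deriv[OF V(3,1)]]
    by (auto intro!: continuous_intros)
  define U where "U = {w\<in>V. deriv f w \<noteq> 0} \<inter> {w\<in>V. c * f w + d \<noteq> 0}"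
  have "open {w\<in>V. h w \<noteq> 0}" if "continuous_on V h" for h :: "complex \<Rightarrow> complex"
    using continuous_open_preimage[OF that V(1), of "- {0}"]
    by (simp add: vimage_def Collect_conj_eq open_Compl)
  then have U: "open U" "z \<in> U"
    using cont V f nz by (auto simp: U_def)
  have hol: "f holomorphic_on U" "deriv f holomorphic_on U" "deriv (deriv f) holomorphic_on U"
    using V holomorphic_on_subset[of f V U] U by (auto simp: U_def intro!: holomorphic_deriv)
  note der = hol[THEN holomorphic_derivI, OF U(1)]
  have nzU: "deriv f w \<noteq> 0" "c * f w + d \<noteq> 0" if "w \<in> U" for w
    using that by (auto simp: U_def)
  define D where "D = a * d - b * c"
  define t where "t = (\<lambda>w. c * f w + d)"
  have t: "(t has_field_derivative c * deriv f w) (at w)" "t w \<noteq> 0" if "w \<in> U" for w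
    using nzU[OF that] unfolding t_def by (auto intro!: derivative_eq_intros der(1)[OF that])
  have ev: "\<forall>\<^sub>F v in nhds w. v \<in> U" if "w \<in> U" for w
    using U(1) that by (rule eventually_nhds_in_open)
  have d1: "deriv g w = D * deriv f w / (t w)\<^sup>2" if w: "w \<in> U" for w
    unfolding g_def t_def
  proof (rule DERIV_imp_deriv)
    show "((\<lambda>w. (a * f w + b) / (c * f w + d)) has_field_derivative D * deriv f w / (c * f w + d)\<^sup>2) (at w)"
      using nzU[OF w]
      by (auto intro!: derivative_eq_intros der(1)[OF w] simp: D_def power2_eq_square field_simps)
  qed
  have d2: "deriv (deriv g) w = D * (deriv (deriv f) w / (t w)\<^sup>2 - 2 * c * (deriv f w)\<^sup>2 / (t w) ^ 3)"
    if w: "w \<in> U" for w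
  proof -
    have "deriv (deriv g) w = deriv (\<lambda>v. D * deriv f v / (t v)\<^sup>2) w"
      using ev[OF w] by (intro deriv_cong_ev) (auto elim!: eventually_mono simp: d1)
    moreover have "((\<lambda>v. D * deriv f v / (t v)\<^sup>2) has_field_derivative
        D * (deriv (deriv f) w / (t w)\<^sup>2 - 2 * c * (deriv f w)\<^sup>2 / (t w) ^ 3)) (at w)"
      using t(2)[OF w]
      by (auto intro!: derivative_eq_intros t(1)[OF w] der(2)[OF w]
          simp: power2_eq_square power3_eq_cube field_simps)
    ultimately show ?thesis
      by (simp add: DERIV_imp_deriv)
  qed
  show an: "g analytic_on {z}"
    unfolding g_def using f nz by (auto intro!: analytic_intros)
  show nz': "deriv g z \<noteq> 0"
    using d1[OF U(2)] nzU[OF U(2)] t(2)[OF U(2)] det by (simp add: D_def)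
  have pre: "deriv (deriv g) w / deriv g w = deriv (deriv f) w / deriv f w - 2 * c * deriv f w / t w"
    if w: "w \<in> U" for w
    using nzU(1)[OF w] t(2)[OF w] det unfolding d1[OF w] d2[OF w]
    by (simp add: D_def[symmetric] power2_eq_square power3_eq_cube field_simps)
  have "deriv (\<lambda>w. deriv (deriv g) w / deriv g w) z
      = deriv (\<lambda>w. deriv (deriv f) w / deriv f w - 2 * c * deriv f w / t w) z"
    using ev[OF U(2)] by (intro deriv_cong_ev) (auto elim!: eventually_mono simp: pre)
  also have "\<dots> = deriv (\<lambda>w. deriv (deriv f) w / deriv f w) z
      - 2 * c * (deriv (deriv f) z * t z - c * (deriv f z)\<^sup>2) / (t z)\<^sup>2"
  proof (rule DERIV_imp_deriv, rule DERIV_diff)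
    have "(\<lambda>w. deriv (deriv f) w / deriv f w) holomorphic_on U"
      using nzU(1) hol by (intro holomorphic_on_divide) auto
    then show "((\<lambda>w. deriv (deriv f) w / deriv f w) has_field_derivative
        deriv (\<lambda>w. deriv (deriv f) w / deriv f w) z) (at z)"
      using U by (rule holomorphic_derivI)
    show "((\<lambda>w. 2 * c * deriv f w / t w) has_field_derivative
        2 * c * (deriv (deriv f) z * t z - c * (deriv f z)\<^sup>2) / (t z)\<^sup>2) (at z)"
      using t(2)[OF U(2)]
      by (auto intro!: derivative_eq_intros t(1)[OF U(2)] der(2)[OF U(2)]
          simp: power2_eq_square field_simps)
  qed
  finally have "deriv (\<lambda>w. deriv (deriv g) w / deriv g w) z = deriv (\<lambda>w. deriv (deriv f) w / deriv f w) z
      - 2 * c * (deriv (deriv f) z * t z - c * (deriv f z)\<^sup>2) / (t z)\<^sup>2" .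
  then show "schwarzian g z = schwarzian f z"
    using nzU(1)[OF U(2)] t(2)[OF U(2)]
    unfolding schwarzian_eq_pre_schwarzian[OF f] schwarzian_eq_pre_schwarzian[OF an nz'] pre[OF U(2)]
    by (simp only:) (simp add: power2_eq_square field_simps)
qed

lemma schwarzian_exp_mult:
  assumes "a \<noteq> 0"
  shows "schwarzian (\<lambda>z. exp (a * z)) z = - a\<^sup>2 / 2"
proof -
  have d: "deriv (\<lambda>z. k * exp (a * z)) = (\<lambda>z. (k * a) * exp (a * z))" for k
    by (intro ext DERIV_imp_deriv) (auto intro!: derivative_eq_intros)
  then have "deriv (\<lambda>z. exp (a * z)) = (\<lambda>z. a * exp (a * z))"
    using d[of 1] by simp
  then show ?thesis
    using assms by (simp add: schwarzian_def numeral_2_eq_2 numeral_3_eq_3 d power2_eq_square)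
qed

lemma schwarzian_ident: "schwarzian (\<lambda>z. z) z = 0"
  by (simp add: schwarzian_def numeral_2_eq_2 numeral_3_eq_3)

text \<open>
  The nonlinear equation \<open>S(f) = s\<close> linearises: \<open>v = (f')^{-1/2}\<close> and \<open>f v\<close> both solve
  \<open>y'' = -(s/2) y\<close>, and their Wronskian is \<open>f' v\<^sup>2 = 1\<close>. A branch of the root exists because the domain
  is convex.
\<close>

lemma schwarzian_linear_ode:
  assumes B: "convex B" "open B" "z0 \<in> B" and f: "f holomorphic_on B" "\<And>z. z \<in> B \<Longrightarrow> deriv f z \<noteq> 0"
    and S: "\<And>z. z \<in> B \<Longrightarrow> schwarzian f z = S z"
  obtains v v' where
    "\<And>z. z \<in> B \<Longrightarrow> (v has_field_derivative v' z) (at z)"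
    "\<And>z. z \<in> B \<Longrightarrow> (v' has_field_derivative - (S z / 2) * v z) (at z)"
    "\<And>z. z \<in> B \<Longrightarrow> deriv f z * (v z)\<^sup>2 = 1"
    "\<And>z. z \<in> B \<Longrightarrow> ((\<lambda>z. deriv f z * v z + f z * v' z) has_field_derivative
        - (S z / 2) * (f z * v z)) (at z)"
proof -
  obtain g where g: "g holomorphic_on B" "\<And>z. z \<in> B \<Longrightarrow> exp (g z) = deriv f z"
    using holomorphic_logarithm_exists[OF B(1,2) holomorphic_deriv[OF f(1) B(2)] f(2) B(3)] by blast
  define v where "v = (\<lambda>z. exp (- g z / 2))"
  define v' where "v' = (\<lambda>z. - (deriv g z / 2) * exp (- g z / 2))"
  note dg = holomorphic_derivI[OF g(1) B(2)]
  note dg' = holomorphic_derivI[OF holomorphic_deriv[OF g(1) B(2)] B(2)]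
  note df = holomorphic_derivI[OF f(1) B(2)]
  have Sz: "S z = deriv (deriv g) z - (deriv g z)\<^sup>2 / 2" if "z \<in> B" for z
    using schwarzian_exp_derivative[OF B(2) g(1) g(2)[symmetric] that] S[OF that] by (simp add: numeral_2_eq_2)
  have v: "(v has_field_derivative v' z) (at z)" if "z \<in> B" for z
    unfolding v_def v'_def by (auto intro!: derivative_eq_intros dg[OF that])
  have v': "(v' has_field_derivative - (S z / 2) * v z) (at z)" if "z \<in> B" for z
    unfolding v_def v'_def Sz[OF that]
    by (auto intro!: derivative_eq_intros dg[OF that] dg'[OF that]) (simp add: power2_eq_square algebra_simps)
  have fv: "deriv f z * (v z)\<^sup>2 = 1" if "z \<in> B" for z
    using g(2)[OF that, symmetric] by (simp add: v_def power2_eq_square flip: exp_add)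
  have "(deriv f has_field_derivative deriv f z * deriv g z) (at z)" if z: "z \<in> B" for z
  proof (rule has_field_derivative_transform_within_open[OF _ B(2) z g(2)])
    show "((\<lambda>z. exp (g z)) has_field_derivative deriv f z * deriv g z) (at z)"
      using DERIV_chain2[OF DERIV_exp dg[OF z]] g(2)[OF z] by simp
  qed auto
  then have "((\<lambda>z. deriv f z * v z + f z * v' z) has_field_derivative
        - (S z / 2) * (f z * v z)) (at z)" if "z \<in> B" for z
    using that
    by (auto intro!: derivative_eq_intros v[OF that] v'[OF that] df[OF that])
       (simp add: v'_def v_def algebra_simps)
  with v v' fv show thesis
    by (rule that)
qed

text \<open>
  Let \<open>v = (f')^{-1/2}\<close> and \<open>u = (h')^{-1/2}\<close>. All of \<open>v\<close>, \<open>f v\<close>, \<open>u\<close>, \<open>h u\<close> solve the same second-order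
  linear equation, and \<open>u\<close>, \<open>h u\<close> form a basis of its solutions, so \<open>f = (f v) / v\<close> is a quotient of
  two linear combinations of \<open>h u\<close> and \<open>u\<close>.
\<close>

lemma schwarzian_eq_imp_moebius:
  assumes B: "convex B" "open B" "B \<noteq> {}"
    and f: "f holomorphic_on B" "\<And>z. z \<in> B \<Longrightarrow> deriv f z \<noteq> 0"
    and h: "h holomorphic_on B" "\<And>z. z \<in> B \<Longrightarrow> deriv h z \<noteq> 0"
    and eq: "\<And>z. z \<in> B \<Longrightarrow> schwarzian f z = schwarzian h z"
  shows "\<exists>a b c d. a * d - b * c \<noteq> 0 \<and>
           (\<forall>z\<in>B. c * h z + d \<noteq> 0 \<and> f z = (a * h z + b) / (c * h z + d))"
proof -
  obtain z0 where z0: "z0 \<in> B"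
    using B by blast
  obtain v v' where v:
    "\<And>z. z \<in> B \<Longrightarrow> (v has_field_derivative v' z) (at z)"
    "\<And>z. z \<in> B \<Longrightarrow> (v' has_field_derivative - (schwarzian h z / 2) * v z) (at z)"
    "\<And>z. z \<in> B \<Longrightarrow> deriv f z * (v z)\<^sup>2 = 1"
    "\<And>z. z \<in> B \<Longrightarrow> ((\<lambda>z. deriv f z * v z + f z * v' z) has_field_derivative
        - (schwarzian h z / 2) * (f z * v z)) (at z)"
    by (rule schwarzian_linear_ode[OF B(1,2) z0 f eq], assumption, assumption, rule that)
  obtain u u' where u:
    "\<And>z. z \<in> B \<Longrightarrow> (u has_field_derivative u' z) (at z)"
    "\<And>z. z \<in> B \<Longrightarrow> (u' has_field_derivative - (schwarzian h z / 2) * u z) (at z)"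
    "\<And>z. z \<in> B \<Longrightarrow> deriv h z * (u z)\<^sup>2 = 1"
    "\<And>z. z \<in> B \<Longrightarrow> ((\<lambda>z. deriv h z * u z + h z * u' z) has_field_derivative
        - (schwarzian h z / 2) * (h z * u z)) (at z)"
    by (rule schwarzian_linear_ode[OF B(1,2) z0 h refl], assumption, rule that)
  have df: "(f has_field_derivative deriv f z) (at z)" "(h has_field_derivative deriv h z) (at z)" if "z \<in> B" for z
    using that holomorphic_derivI[OF f(1) B(2)] holomorphic_derivI[OF h(1) B(2)] by auto
  have combination: "\<exists>k l. \<forall>z\<in>B. y z = (k * h z + l) * u z"
    if y: "\<And>z. z \<in> B \<Longrightarrow> (y has_field_derivative y' z) (at z)"
      "\<And>z. z \<in> B \<Longrightarrow> (y' has_field_derivative - (schwarzian h z / 2) * y z) (at z)" for y y'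
  proof -
    \<comment> \<open>The coefficients in the basis \<open>h * u\<close>, \<open>u\<close> are Wronskians, which are constant since the equation
      has no first-order term.\<close>
    define W1 where "W1 = (\<lambda>z. y z * u' z - y' z * u z)"
    define W2 where "W2 = (\<lambda>z. y z * (deriv h z * u z + h z * u' z) - y' z * (h z * u z))"
    have "(W1 has_field_derivative 0) (at z)" if "z \<in> B" for z
      unfolding W1_def
      by (auto intro!: derivative_eq_intros y[OF that] u(1,2)[OF that])
    then obtain k where k: "\<And>z. z \<in> B \<Longrightarrow> W1 z = k"
      using has_field_derivative_zero_constant[OF B(1), of W1] has_field_derivative_at_within by blast
    have "(W2 has_field_derivative 0) (at z)" if "z \<in> B" for z
      unfolding W2_def
      by (rule DERIV_cong[OF DERIV_diff[OF DERIV_mult[OF y(1) u(4)]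
            DERIV_mult[OF y(2) DERIV_mult[OF df(2) u(1)]]]])
         (use that in \<open>simp_all add: algebra_simps\<close>)
    then obtain l where l: "\<And>z. z \<in> B \<Longrightarrow> W2 z = l"
      using has_field_derivative_zero_constant[OF B(1), of W2] has_field_derivative_at_within by blast
    have "y z = (- k * h z + l) * u z" if "z \<in> B" for z
    proof -
      have "(- k * h z + l) * u z = y z * (deriv h z * (u z)\<^sup>2)"
        unfolding k[OF that, symmetric] l[OF that, symmetric] W1_def W2_def
        by (simp add: power2_eq_square algebra_simps)
      then show ?thesis
        using u(3)[OF that] by simp
    qed
    then show ?thesis
      by blast
  qed
  obtain c d where cd: "\<And>z. z \<in> B \<Longrightarrow> v z = (c * h z + d) * u z"
    using combination[of v v'] v by blast
  have "((\<lambda>z. f z * v z) has_field_derivative deriv f z * v z + f z * v' z) (at z)" if "z \<in> B" for z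
    by (auto intro!: derivative_eq_intros df[OF that] v(1)[OF that])
  then obtain a b where ab: "\<And>z. z \<in> B \<Longrightarrow> f z * v z = (a * h z + b) * u z"
    using combination[of "\<lambda>z. f z * v z" "\<lambda>z. deriv f z * v z + f z * v' z"] v(4) by blast
  have nz: "c * h z + d \<noteq> 0" "u z \<noteq> 0" if "z \<in> B" for z
    using v(3)[OF that] cd[OF that] by auto
  have fz: "f z = (a * h z + b) / (c * h z + d)" if "z \<in> B" for z
  proof -
    have "f z * (c * h z + d) * u z = (a * h z + b) * u z"
      using ab[OF that] cd[OF that] by (simp only: mult.assoc)
    then show ?thesis
      using nz[OF that] by (simp add: eq_divide_eq)
  qed
  have "a * d - b * c \<noteq> 0"
  proof
    assume det: "a * d - b * c = 0"
    have "((\<lambda>z. (a * h z + b) / (c * h z + d)) has_field_derivative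
        (a * d - b * c) * deriv h z0 / (c * h z0 + d)\<^sup>2) (at z0)"
      using nz[OF z0] by (auto intro!: derivative_eq_intros df[OF z0] simp: power2_eq_square field_simps)
    then have "(f has_field_derivative 0) (at z0)"
      using det by (simp add: has_field_derivative_transform_within_open[OF _ B(2) z0] fz)
    then show False
      using f(2)[OF z0] DERIV_imp_deriv by blast
  qed
  then show ?thesis
    using nz fz by blast
qed

section \<open>Meromorphic functions as maps to the sphere\<close>

text \<open>
  The values of \<^const>\<open>to_sphere\<close> are limits on the sphere (\<open>sphere_limit_to_sphere\<close> and
  \<open>to_sphere_eqI\<close>), so they can be computed from any function that agrees with the normalised one
  near the point, whatever its default values are.
\<close>

definition sphere_limit :: "(complex \<Rightarrow> complex) \<Rightarrow> complex \<Rightarrow> complex option \<Rightarrow> bool" where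
  "sphere_limit f z w \<longleftrightarrow> (case w of None \<Rightarrow> is_pole f z | Some c \<Rightarrow> f \<midarrow>z\<rightarrow> c)"

lemma sphere_limit_unique:
  assumes "sphere_limit f z v" "sphere_limit f z w"
  shows "v = w"
  using assms LIM_unique[of f] not_tendsto_and_filterlim_at_infinity[of "at z" f]
  by (auto simp: sphere_limit_def is_pole_def split: option.splits)

lemma sphere_limit_cong:
  assumes "\<forall>\<^sub>F x in at z. f x = g x"
  shows "sphere_limit f z w \<longleftrightarrow> sphere_limit g z w"
  using is_pole_cong[OF assms refl] tendsto_cong[OF assms]
  by (auto simp: sphere_limit_def split: option.splits)

lemma sphere_limit_to_sphere:
  assumes "f nicely_meromorphic_on UNIV"
  shows "sphere_limit f z (to_sphere f z)"
  using assms by (auto simp: sphere_limit_def to_sphere_def nicely_meromorphic_on_def)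

lemma to_sphere_eqI:
  assumes "f nicely_meromorphic_on UNIV" "sphere_limit f z w"
  shows "to_sphere f z = w"
  using assms sphere_limit_to_sphere sphere_limit_unique by blast

lemma nicely_meromorphic_eq_to_sphere:
  assumes "f nicely_meromorphic_on UNIV"
  shows "f z = (case to_sphere f z of None \<Rightarrow> 0 | Some w \<Rightarrow> w)"
proof (cases "is_pole f z")
  case True
  then have "f z = 0"
    using assms not_tendsto_and_filterlim_at_infinity[of "at z" f]
    by (auto simp: nicely_meromorphic_on_def is_pole_def)
  with True show ?thesis
    by (simp add: to_sphere_def)
qed (simp add: to_sphere_def)

lemma to_sphere_inject:
  assumes "f nicely_meromorphic_on UNIV" "g nicely_meromorphic_on UNIV" "to_sphere f = to_sphere g"
  shows "f = g"
  using assms nicely_meromorphic_eq_to_sphere by (metis ext)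

lemma to_sphere_entire:
  assumes "f holomorphic_on UNIV"
  shows "to_sphere f = Some \<circ> f"
  using assms not_is_pole_holomorphic[of UNIV] by (auto simp: to_sphere_def)

lemma entire_nicely_meromorphic:
  "f holomorphic_on UNIV \<Longrightarrow> f nicely_meromorphic_on UNIV"
  by (intro analytic_on_imp_nicely_meromorphic_on) (simp add: analytic_on_open)

lemma moebius_inverse:
  assumes "a * d - b * c \<noteq> 0"
  shows "moebius d (- b) (- c) a (moebius a b c d w) = w"
proof (cases w)
  case None
  with assms show ?thesis
    by (auto simp: moebius_def field_simps)
next
  case (Some z)
  show ?thesis
  proof (cases "c * z + d = 0")
    case True
    then have "c \<noteq> 0"
      using assms by auto
    then have "z = - d / c"
      using True by (simp add: field_simps add_eq_0_iff)
    with Some True \<open>c \<noteq> 0\<close> show ?thesis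
      by (simp add: moebius_def)
  next
    case False
    have "- c * ((a * z + b) / (c * z + d)) + a = (a * d - b * c) / (c * z + d)"
      using False by (simp add: field_simps)
    moreover have "d * ((a * z + b) / (c * z + d)) + - b = (a * d - b * c) * z / (c * z + d)"
      using False by (simp add: field_simps)
    ultimately show ?thesis
      using Some False assms by (simp add: moebius_def)
  qed
qed

lemma inj_moebius:
  assumes "a * d - b * c \<noteq> 0"
  shows "inj (moebius a b c d)"
  using moebius_inverse[OF assms] by (metis injI)

lemma sphere_limit_moebius:
  assumes det: "a * d - b * c \<noteq> 0" and lim: "sphere_limit f z w"
    and nz: "\<forall>\<^sub>F x in at z. c * f x + d \<noteq> 0"
  shows "sphere_limit (\<lambda>x. (a * f x + b) / (c * f x + d)) z (moebius a b c d w)"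
proof (cases w)
  case (Some y)
  then have y: "f \<midarrow>z\<rightarrow> y"
    using lim by (simp add: sphere_limit_def)
  have num: "(\<lambda>x. a * f x + b) \<midarrow>z\<rightarrow> a * y + b" and den: "(\<lambda>x. c * f x + d) \<midarrow>z\<rightarrow> c * y + d"
    by (intro tendsto_intros y)+
  show ?thesis
  proof (cases "c * y + d = 0")
    case False
    then show ?thesis
      using tendsto_divide[OF num den False] Some by (simp add: sphere_limit_def moebius_def)
  next
    case True
    have "a * y + b \<noteq> 0"
    proof
      assume "a * y + b = 0"
      then have "a * d - b * c = 0"
        using True by algebra
      with det show False by simp
    qed
    moreover have "filterlim (\<lambda>x. c * f x + d) (at 0) (at z)"
      using den nz True by (simp add: filterlim_at)
    ultimately have "filterlim (\<lambda>x. (a * f x + b) / (c * f x + d)) at_infinity (at z)"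
      using filterlim_divide_at_infinity[OF num] by blast
    then show ?thesis
      using Some True by (simp add: sphere_limit_def moebius_def is_pole_def)
  qed
next
  case None
  then have inf: "filterlim f at_infinity (at z)"
    using lim by (simp add: sphere_limit_def is_pole_def)
  have affine: "filterlim (\<lambda>x. k * f x + l) at_infinity (at z)" if "k \<noteq> 0" for k l
    using tendsto_add_filterlim_at_infinity'[OF tendsto_mult_filterlim_at_infinity[OF tendsto_const that inf] tendsto_const]
    by simp
  show ?thesis
  proof (cases "c = 0")
    case True
    then have "a / d \<noteq> 0"
      using det by auto
    from affine[OF this, of "b / d"] show ?thesis
      using None True by (simp add: sphere_limit_def moebius_def is_pole_def add_divide_distrib)
  next
    case False
    have "(\<lambda>x. a / c + ((b * c - a * d) / c) / (c * f x + d)) \<midarrow>z\<rightarrow> a / c + 0"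
      by (intro tendsto_intros tendsto_divide_0[OF tendsto_const] affine False)
    moreover have "\<forall>\<^sub>F x in at z. a / c + ((b * c - a * d) / c) / (c * f x + d) = (a * f x + b) / (c * f x + d)"
      using nz by eventually_elim (use False in \<open>simp add: divide_simps\<close>, simp add: algebra_simps)
    ultimately have "(\<lambda>x. (a * f x + b) / (c * f x + d)) \<midarrow>z\<rightarrow> a / c"
      using tendsto_cong by force
    then show ?thesis
      using None False by (simp add: sphere_limit_def moebius_def)
  qed
qed

lemma nonconstant_avoids_cosparse:
  assumes "f nicely_meromorphic_on UNIV" "\<not> f constant_on UNIV"
  shows "\<forall>\<^sub>\<approx>z. f z \<noteq> c"
  using nicely_meromorphic_imp_constant_or_avoid[OF assms(1), of c] assms(2)
  by (auto simp: constant_on_def)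

lemma analytic_cosparse:
  assumes "f nicely_meromorphic_on UNIV"
  shows "\<forall>\<^sub>\<approx>z. f analytic_on {z}"
  using assms by (intro meromorphic_on_imp_analytic_cosparse) (simp add: nicely_meromorphic_on_def)

lemma nicely_meromorphic_eqI:
  assumes f: "f nicely_meromorphic_on UNIV" and g: "g nicely_meromorphic_on UNIV"
    and eq: "\<And>z. z \<in> ball z0 r \<Longrightarrow> f z = g z" and "r > 0"
  shows "f = g"
proof -
  have "(\<lambda>z. f z - g z) meromorphic_on UNIV"
    using f g by (auto simp: nicely_meromorphic_on_def intro!: meromorphic_intros)
  from meromorphic_imp_constant_or_avoid[OF this open_UNIV connected_UNIV, of 0]
  have "\<forall>\<^sub>\<approx>z. f z - g z = 0"
  proof
    assume "\<forall>\<^sub>\<approx>z. f z - g z \<noteq> 0"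
    then have "\<forall>\<^sub>F z in at z0. f z - g z \<noteq> 0"
      by (simp add: eventually_cosparse_open_eq)
    moreover have "\<forall>\<^sub>F z in at z0. z \<in> ball z0 r"
      using \<open>r > 0\<close> by (intro eventually_at_in_open') auto
    ultimately have "\<forall>\<^sub>F z in at z0. False"
      by eventually_elim (use eq in auto)
    then show ?thesis
      by simp
  qed
  then have ev: "\<forall>\<^sub>F x in at z. f x = g x" for z
    by (simp add: eventually_cosparse_open_eq)
  show ?thesis
    using to_sphere_eqI[OF g] sphere_limit_cong[OF ev] sphere_limit_to_sphere[OF f]
    by (intro to_sphere_inject f g) (metis ext)
qed

lemma deriv_nonzero_cosparse:
  assumes f: "f nicely_meromorphic_on UNIV" "\<not> f constant_on UNIV"
  shows "\<forall>\<^sub>\<approx>z. deriv f z \<noteq> 0"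
proof -
  have "deriv f meromorphic_on UNIV"
    using f by (auto simp: nicely_meromorphic_on_def intro!: meromorphic_intros)
  from meromorphic_imp_constant_or_avoid[OF this open_UNIV connected_UNIV, of 0]
  show ?thesis
  proof
    assume "\<forall>\<^sub>\<approx>z. deriv f z = 0"
    obtain z0 where "f analytic_on {z0}"
      using eventually_happens[OF analytic_cosparse[OF f(1)]] by auto
    then obtain r1 where r1: "r1 > 0" "f holomorphic_on ball z0 r1"
      by (auto simp: analytic_on_def)
    have "\<forall>\<^sub>F z in at z0. deriv f z = 0"
      using \<open>\<forall>\<^sub>\<approx>z. deriv f z = 0\<close> by (simp add: eventually_cosparse_open_eq)
    moreover have "deriv f \<midarrow>z0\<rightarrow> deriv f z0"
      using \<open>f analytic_on {z0}\<close> by (intro isContD analytic_at_imp_isCont analytic_intros)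
    ultimately have "(\<lambda>_. 0) \<midarrow>z0\<rightarrow> deriv f z0"
      by (rule_tac Lim_transform_eventually)
    then have "deriv f z0 = 0"
      using LIM_const_eq by metis
    then have "\<forall>\<^sub>F z in nhds z0. deriv f z = 0"
      using \<open>\<forall>\<^sub>F z in at z0. deriv f z = 0\<close> by (simp add: eventually_nhds_conv_at)
    then obtain r2 where r2: "r2 > 0" "\<And>z. z \<in> ball z0 r2 \<Longrightarrow> deriv f z = 0"
      by (auto simp: eventually_nhds_metric dist_commute)
    define B where "B = ball z0 (min r1 r2)"
    have "(f has_field_derivative 0) (at z within B)" if "z \<in> B" for z
      using holomorphic_derivI[OF r1(2), of z] r2(2)[of z] that
      by (auto simp: B_def intro: has_field_derivative_at_within)
    then obtain k where "\<And>z. z \<in> B \<Longrightarrow> f z = k"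
      using has_field_derivative_zero_constant[of B f] by (auto simp: B_def)
    then have "f constant_on B"
      by (auto simp: constant_on_def)
    then have "f constant_on UNIV"
      using constant_on_extend_nicely_meromorphic_on[OF f(1) _ _ open_UNIV connected_UNIV, of B] r1 r2
      by (simp add: B_def)
    with f(2) show ?thesis
      by blast
  qed
qed

text \<open>
  The Moebius image of a meromorphic function, with its values normalised by
  \<^const>\<open>remove_sings\<close>. On the sphere it is the composition everywhere; the pointwise formula and the
  invariance of the Schwarzian hold outside the places where default values interfere.
\<close>

lemma moebius_of_meromorphic:
  assumes f: "f nicely_meromorphic_on UNIV" "\<not> f constant_on UNIV" and det: "a * d - b * c \<noteq> 0"
  obtains g where "g nicely_meromorphic_on UNIV" "\<not> g constant_on UNIV"
    "to_sphere g = moebius a b c d \<circ> to_sphere f"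
    "\<forall>\<^sub>\<approx>z. c * f z + d \<noteq> 0 \<and> g z = (a * f z + b) / (c * f z + d)"
    "\<forall>\<^sub>\<approx>z. schwarzian g z = schwarzian f z"
proof -
  define h where "h = (\<lambda>z. (a * f z + b) / (c * f z + d))"
  define g where "g = remove_sings h"
  have "f meromorphic_on UNIV"
    using f by (simp add: nicely_meromorphic_on_def)
  then have h: "h meromorphic_on UNIV"
    unfolding h_def by (intro meromorphic_intros)
  then have g: "g nicely_meromorphic_on UNIV"
    unfolding g_def by (rule remove_sings_nicely_meromorphic)
  have nz: "\<forall>\<^sub>\<approx>z. c * f z + d \<noteq> 0"
  proof (cases "c = 0")
    case False
    then have "c * f z + d \<noteq> 0" if "f z \<noteq> - d / c" for z
      using that by (simp add: field_simps add_eq_0_iff)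
    with nonconstant_avoids_cosparse[OF f, of "- d / c"] show ?thesis
      by (rule_tac eventually_mono)
  qed (use det in auto)
  have gh: "\<forall>\<^sub>\<approx>z. g z = h z"
    unfolding g_def by (rule eventually_remove_sings_eq[OF h])
  have sphere: "to_sphere g = moebius a b c d \<circ> to_sphere f"
  proof
    fix z
    have "sphere_limit h z (moebius a b c d (to_sphere f z))"
      unfolding h_def using nz
      by (intro sphere_limit_moebius det sphere_limit_to_sphere f) (simp add: eventually_cosparse_open_eq)
    moreover have "\<forall>\<^sub>F x in at z. g x = h x"
      using gh by (simp add: eventually_cosparse_open_eq)
    ultimately show "to_sphere g z = (moebius a b c d \<circ> to_sphere f) z"
      using sphere_limit_cong by (simp add: to_sphere_eqI[OF g])
  qed
  have "\<not> g constant_on UNIV"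
  proof
    assume "g constant_on UNIV"
    then obtain k where k: "g = (\<lambda>_. k)"
      by (auto simp: constant_on_def)
    then have "to_sphere g z = to_sphere g 0" for z
      by (simp add: to_sphere_entire)
    then have "to_sphere f z = to_sphere f 0" for z
      using inj_moebius[OF det] by (simp add: sphere inj_eq)
    then have "f z = f 0" for z
      using nicely_meromorphic_eq_to_sphere[OF f(1)] by metis
    then show False
      using f(2) by (auto simp: constant_on_def)
  qed
  moreover have "\<forall>\<^sub>\<approx>z. schwarzian g z = schwarzian f z"
    using nz analytic_cosparse[OF f(1)] deriv_nonzero_cosparse[OF f]
  proof eventually_elim
    case (elim z)
    note S = schwarzian_moebius_compose[OF elim(2,3,1) det]
    have "\<forall>\<^sub>F w in nhds z. g w = h w"
      unfolding g_def using S(1) by (intro eventually_remove_sings_eq_nhds) (simp add: h_def)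
    then show ?case
      using schwarzian_cong[of g h z] S(3) by (simp add: h_def)
  qed
  moreover have "\<forall>\<^sub>\<approx>z. c * f z + d \<noteq> 0 \<and> g z = (a * f z + b) / (c * f z + d)"
    using gh nz by eventually_elim (simp add: h_def)
  ultimately show thesis
    using that g sphere by blast
qed

lemma locally_injective_inj_compose:
  assumes "locally_injective f" "to_sphere g = m \<circ> to_sphere f" "inj m"
  shows "locally_injective g"
  unfolding locally_injective_def
proof
  fix z
  obtain U where "open U" "z \<in> U" "inj_on (to_sphere f) U"
    using assms(1) by (auto simp: locally_injective_def)
  moreover from this have "inj_on (to_sphere g) U"
    unfolding assms(2) using assms(3) by (intro comp_inj_on) (auto intro: inj_on_subset)
  ultimately show "\<exists>U. open U \<and> z \<in> U \<and> inj_on (to_sphere g) U"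
    by blast
qed

lemma locally_injective_deriv_nonzero:
  assumes "locally_injective f" "f analytic_on {z}"
  shows "deriv f z \<noteq> 0"
proof -
  obtain U where U: "open U" "z \<in> U" "inj_on (to_sphere f) U"
    using assms(1) by (auto simp: locally_injective_def)
  obtain V where V: "open V" "z \<in> V" "f holomorphic_on V"
    using assms(2) by (auto simp: analytic_at)
  have "to_sphere f w = Some (f w)" if "w \<in> V" for w
    using that V not_is_pole_holomorphic[OF V(1) that V(3)] by (simp add: to_sphere_def)
  then have "inj_on f (U \<inter> V)"
    using U(3) by (auto simp: inj_on_def)
  then show ?thesis
    using U V by (intro holomorphic_injective_imp_regular[of f "U \<inter> V"])
      (auto intro: holomorphic_on_subset)
qed

text \<open>
  The domination excludes poles, and then the entire case applies: local injectivity makes the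
  derivative zero-free and the Schwarzian analytic, so the inequality extends by continuity from
  almost all points to all points.
\<close>

theorem locally_injective_not_dominated_by_schwarzian:
  assumes f: "f nicely_meromorphic_on UNIV" "\<not> f constant_on UNIV" "locally_injective f"
    and p: "p \<ge> 1"
    and dom: "\<forall>\<^sub>\<approx>z. norm (f z) > C \<longrightarrow> norm (f z) \<le> K * norm (schwarzian f z) ^ p"
  shows False
proof -
  have dom_at: "\<forall>\<^sub>F w in at z. norm (f w) > C \<longrightarrow> norm (f w) \<le> K * norm (schwarzian f w) ^ p" for z
    using dom by (simp add: eventually_cosparse_open_eq)
  \<comment> \<open>At a pole of \<open>f\<close>, the function \<open>g = 1/f\<close> is analytic with nonzero derivative, so
    \<open>S(f) = S(g)\<close> stays bounded while \<open>f\<close> does not.\<close>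
  have "\<not> is_pole f z" for z
  proof
    assume pole: "is_pole f z"
    obtain g where g: "g nicely_meromorphic_on UNIV" "\<not> g constant_on UNIV"
      "to_sphere g = moebius 0 1 1 0 \<circ> to_sphere f"
      "\<forall>\<^sub>\<approx>z. schwarzian g z = schwarzian f z"
      using moebius_of_meromorphic[OF f(1,2), of 0 0 1 1] by auto
    have "to_sphere g z = Some 0"
      using pole by (simp add: g(3) moebius_def to_sphere_def)
    then have "\<not> is_pole g z"
      by (auto simp: to_sphere_def split: if_splits)
    then have an: "g analytic_on {z}"
      using g(1) nicely_meromorphic_on_imp_analytic_at by blast
    have "locally_injective g"
      using locally_injective_inj_compose[OF f(3) g(3)] inj_moebius[of 0 0 1 1] by simp
    then have "schwarzian g analytic_on {z}"
      using schwarzian_analytic[OF an] locally_injective_deriv_nonzero an by blast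
    then have "((\<lambda>w. \<bar>K\<bar> * norm (schwarzian g w) ^ p) \<longlongrightarrow> \<bar>K\<bar> * norm (schwarzian g z) ^ p) (at z)"
      by (intro tendsto_intros isContD analytic_at_imp_isCont)
    then have "\<forall>\<^sub>F w in at z. \<bar>K\<bar> * norm (schwarzian g w) ^ p < \<bar>K\<bar> * norm (schwarzian g z) ^ p + 1"
      by (rule order_tendstoD(2)) simp
    moreover have "\<forall>\<^sub>F w in at z. norm (f w) \<ge> max (C + 1) (\<bar>K\<bar> * norm (schwarzian g z) ^ p + 1)"
      using pole filterlim_at_infinity_imp_norm_at_top[of f "at z"]
      unfolding is_pole_def filterlim_at_top by blast
    moreover have "\<forall>\<^sub>F w in at z. schwarzian g w = schwarzian f w"
      using g(4) by (simp add: eventually_cosparse_open_eq)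
    ultimately have "\<forall>\<^sub>F w in at z. False"
      using dom_at[of z]
    proof eventually_elim
      case (elim w)
      have "norm (f w) \<le> K * norm (schwarzian f w) ^ p"
        using elim(2,4) by simp
      also have "\<dots> \<le> \<bar>K\<bar> * norm (schwarzian g w) ^ p"
        unfolding elim(3) by (intro mult_right_mono) auto
      finally show ?case
        using elim(1,2) by simp
    qed
    then show False
      by simp
  qed
  then have an: "f analytic_on {z}" for z
    using f(1) nicely_meromorphic_on_imp_analytic_at by blast
  then have hol: "f holomorphic_on UNIV"
    using analytic_on_analytic_at[of f UNIV] by (simp add: analytic_on_open)
  have f': "deriv f z \<noteq> 0" for z
    using locally_injective_deriv_nonzero[OF f(3) an] .
  have "norm (f z) \<le> K * norm (schwarzian f z) ^ p" if "norm (f z) > C" for z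
  proof (rule tendsto_le)
    show "((\<lambda>w. norm (f w)) \<longlongrightarrow> norm (f z)) (at z)"
      by (intro tendsto_intros isContD analytic_at_imp_isCont an)
    then have "\<forall>\<^sub>F w in at z. norm (f w) > C"
      using that by (rule order_tendstoD(1))
    with dom_at[of z] show "\<forall>\<^sub>F w in at z. norm (f w) \<le> K * norm (schwarzian f w) ^ p"
      by eventually_elim auto
    show "((\<lambda>w. K * norm (schwarzian f w) ^ p) \<longlongrightarrow> K * norm (schwarzian f z) ^ p) (at z)"
      by (intro tendsto_intros isContD analytic_at_imp_isCont schwarzian_analytic an f')
  qed auto
  then show False
    using entire_locally_univalent_not_dominated_by_schwarzian[OF hol f' p] by blast
qed

section \<open>Poles of the coefficient and the constant Schwarzian\<close>

text \<open>
  The Moebius map in question sends the pole to infinity: it is \<open>w\<close> or \<open>1 / (w - w\<^sub>1)\<close>. Near the pole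
  \<open>P/Q\<close> grows at least as fast as this map, which has a simple pole there.
\<close>

lemma rat_map_pole_dominates_moebius:
  assumes PQ: "coprime P Q" "Q \<noteq> 0" and pole: "rat_map P Q w0 = None"
  obtains a b c d C K where "a * d - b * c \<noteq> 0"
    "\<And>w. norm ((a * w + b) / (c * w + d)) > C \<Longrightarrow>
      norm ((a * w + b) / (c * w + d)) \<le> K * norm (poly P w / poly Q w)"
proof (cases w0)
  case None
  define n where "n = degree P"
  define m where "m = degree Q"
  have less: "m < n" "P \<noteq> 0"
    using pole None by (auto simp: rat_map_def n_def m_def split: if_splits)
  have lim: "((\<lambda>w. (poly Q w / w ^ m) / (poly P w / w ^ n)) \<longlongrightarrow> lead_coeff Q / lead_coeff P) at_infinity"
    unfolding n_def m_def using less by (intro tendsto_divide poly_divide_tendsto_aux) auto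
  have Q_nz: "\<forall>\<^sub>F w in at_infinity. poly Q w \<noteq> 0"
    using tendsto_imp_eventually_ne[OF poly_divide_tendsto_aux[of Q], of 0] PQ(2)
    by (auto elim: eventually_mono)
  have P_nz: "\<forall>\<^sub>F w in at_infinity. poly P w \<noteq> 0"
    using tendsto_imp_eventually_ne[OF poly_divide_tendsto_aux[of P], of 0] less
    by (auto elim: eventually_mono)
  define K where "K = norm (lead_coeff Q / lead_coeff P) + 1"
  have "\<forall>\<^sub>F w in at_infinity. norm ((poly Q w / w ^ m) / (poly P w / w ^ n)) < K"
    by (rule order_tendstoD(2)[OF tendsto_norm[OF lim]]) (simp add: K_def)
  moreover have "\<forall>\<^sub>F w::complex in at_infinity. norm w \<ge> 1"
    by (rule eventually_at_infinityI)
  ultimately have "\<forall>\<^sub>F w in at_infinity. norm w \<le> K * norm (poly P w / poly Q w)"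
    using Q_nz P_nz
  proof eventually_elim
    case (elim w)
    have w: "w \<noteq> 0"
      using elim(2) by auto
    have "norm w = norm w ^ 1"
      by simp
    also have "\<dots> \<le> norm w ^ (n - m)"
      using elim(2) less by (intro power_increasing) auto
    also have "\<dots> = norm (w ^ n / w ^ m)"
      using less w by (simp add: norm_divide norm_power power_diff)
    also have "w ^ n / w ^ m = ((poly Q w / w ^ m) / (poly P w / w ^ n)) * (poly P w / poly Q w)"
      using elim(3,4) w by (simp add: field_simps)
    also have "norm \<dots> \<le> K * norm (poly P w / poly Q w)"
      unfolding norm_mult using elim(1) by (intro mult_right_mono) auto
    finally show ?case .
  qed
  then obtain C where "\<And>w. norm w \<ge> C \<Longrightarrow> norm w \<le> K * norm (poly P w / poly Q w)"
    by (auto simp: eventually_at_infinity)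
  then show thesis
    using that[of 1 1 0 0 C K] by simp
next
  case (Some w1)
  then have root: "poly Q w1 = 0"
    using pole by (auto simp: rat_map_def split: if_splits)
  then obtain Q1 where Q1: "Q = [:- w1, 1:] * Q1"
    by (auto simp: poly_eq_0_iff_dvd)
  have "poly P w1 \<noteq> 0"
    using root PQ(1) coprime_poly_0 by blast
  define K where "K = norm (poly Q1 w1 / poly P w1) + 1"
  have cont: "poly p \<midarrow>w1\<rightarrow> poly p w1" for p :: "complex poly"
    by (intro isContD) simp
  have "\<forall>\<^sub>F w in at w1. norm (poly Q1 w / poly P w) < K"
    using \<open>poly P w1 \<noteq> 0\<close>
    by (intro order_tendstoD(2)[OF tendsto_norm[OF tendsto_divide[OF cont cont]]]) (auto simp: K_def)
  moreover have "\<forall>\<^sub>F w in at w1. poly P w \<noteq> 0"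
    using \<open>poly P w1 \<noteq> 0\<close> by (intro tendsto_imp_eventually_ne[OF cont])
  moreover have "\<forall>\<^sub>F w in at w1. poly Q w \<noteq> 0"
  proof -
    have "finite ({w. poly Q w = 0} - {w1})"
      using poly_roots_finite[OF PQ(2)] by simp
    then have "\<forall>\<^sub>F w in at w1. w \<in> - ({w. poly Q w = 0} - {w1}) - {w1}"
      by (intro eventually_at_in_open open_Compl finite_imp_closed) auto
    then show ?thesis
      by eventually_elim auto
  qed
  ultimately have "\<forall>\<^sub>F w in at w1. norm (1 / (w - w1)) \<le> K * norm (poly P w / poly Q w)"
  proof eventually_elim
    case (elim w)
    have Qw: "poly Q w = (w - w1) * poly Q1 w"
      by (simp add: Q1 algebra_simps)
    have "1 / (w - w1) = (poly Q1 w / poly P w) * (poly P w / poly Q w)"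
      using elim(2,3) unfolding Qw by simp
    also have "norm \<dots> \<le> K * norm (poly P w / poly Q w)"
      unfolding norm_mult using elim(1) by (intro mult_right_mono) auto
    finally show ?case .
  qed
  then obtain e where e: "e > 0"
    "\<And>w. w \<noteq> w1 \<Longrightarrow> dist w w1 < e \<Longrightarrow> norm (1 / (w - w1)) \<le> K * norm (poly P w / poly Q w)"
    by (auto simp: eventually_at)
  show thesis
  proof (rule that[of 0 "- w1" 1 1 "1 / e" K])
    fix w
    assume "norm ((0 * w + 1) / (1 * w + - w1)) > 1 / e"
    then have big: "1 / e < 1 / norm (w - w1)"
      by (simp add: norm_divide)
    have "w \<noteq> w1"
      using big e(1) by (auto simp: divide_less_0_iff)
    with big e(1) have "dist w w1 < e"
      by (simp add: dist_norm field_simps)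
    with e(2)[OF \<open>w \<noteq> w1\<close>] show
      "norm ((0 * w + 1) / (1 * w + - w1)) \<le> K * norm (poly P w / poly Q w)"
      by simp
  qed simp
qed

lemma rat_map_no_pole_imp_constant:
  assumes "Q \<noteq> 0" "\<And>w. rat_map P Q w \<noteq> None"
  obtains k l where "P = [:k:]" "Q = [:l:]" "l \<noteq> 0"
proof -
  have "poly Q z \<noteq> 0" for z
    using assms(2)[of "Some z"] by (auto simp: rat_map_def)
  then have "degree Q = 0"
    using fundamental_theorem_of_algebra_alt[of Q] assms(1) by (metis degree_pCons_0)
  moreover from this have "degree P = 0"
    using assms(2)[of None] by (auto simp: rat_map_def split: if_splits)
  ultimately show thesis
    using that assms(1) by (metis degree_eq_zeroE pCons_0_0)
qed

lemma locally_injective_solution_no_coefficient_pole: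
  assumes p: "p \<ge> 1" and PQ: "Q \<noteq> 0" "coprime P Q"
    and f: "schwarzian_solution p P Q f" "locally_injective f"
  shows "rat_map P Q w \<noteq> None"
proof
  assume "rat_map P Q w = None"
  then obtain a b c d C K where det: "a * d - b * c \<noteq> 0"
    and dom: "\<And>w. norm ((a * w + b) / (c * w + d)) > C \<Longrightarrow>
      norm ((a * w + b) / (c * w + d)) \<le> K * norm (poly P w / poly Q w)"
    using rat_map_pole_dominates_moebius[OF PQ(2,1)] by metis
  have sol: "f nicely_meromorphic_on UNIV" "\<not> f constant_on UNIV"
    "\<forall>\<^sub>\<approx>z. schwarzian f z ^ p = poly P (f z) / poly Q (f z)"
    using f(1) by (auto simp: schwarzian_solution_def)
  obtain g where g: "g nicely_meromorphic_on UNIV" "\<not> g constant_on UNIV"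
    "to_sphere g = moebius a b c d \<circ> to_sphere f"
    "\<forall>\<^sub>\<approx>z. c * f z + d \<noteq> 0 \<and> g z = (a * f z + b) / (c * f z + d)"
    "\<forall>\<^sub>\<approx>z. schwarzian g z = schwarzian f z"
    using moebius_of_meromorphic[OF sol(1,2) det] by blast
  have "locally_injective g"
    using locally_injective_inj_compose[OF f(2) g(3) inj_moebius[OF det]] .
  moreover have "\<forall>\<^sub>\<approx>z. norm (g z) > C \<longrightarrow> norm (g z) \<le> K * norm (schwarzian g z) ^ p"
    using sol(3) g(4,5)
  proof eventually_elim
    case (elim z)
    have "norm (poly P (f z) / poly Q (f z)) = norm (schwarzian g z) ^ p"
      using elim by (simp flip: norm_power)
    with dom[of "f z"] elim show ?case
      by simp
  qed
  ultimately show False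
    using locally_injective_not_dominated_by_schwarzian[OF g(1,2) _ p] by blast
qed

text \<open>
  On a disc where \<open>f\<close> is analytic with nonzero derivative, \<open>S(f)\<close> is continuous with values among the
  finitely many \<open>p\<close>-th roots of \<open>k\<close>.
\<close>

lemma schwarzian_power_const_local:
  assumes f: "f nicely_meromorphic_on UNIV" "\<not> f constant_on UNIV" and p: "p \<ge> 1"
    and S: "\<forall>\<^sub>\<approx>z. schwarzian f z ^ p = k"
  obtains z0 r c where "r > 0" "f holomorphic_on ball z0 r" "c ^ p = k"
    "\<And>z. z \<in> ball z0 r \<Longrightarrow> deriv f z \<noteq> 0" "\<And>z. z \<in> ball z0 r \<Longrightarrow> schwarzian f z = c"
proof -
  have "\<forall>\<^sub>\<approx>z. f analytic_on {z} \<and> deriv f z \<noteq> 0"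
    using analytic_cosparse[OF f(1)] deriv_nonzero_cosparse[OF f] by eventually_elim simp
  then obtain z0 where z0: "f analytic_on {z0}" "deriv f z0 \<noteq> 0"
    using eventually_happens by fastforce
  obtain r1 where r1: "r1 > 0" "f holomorphic_on ball z0 r1"
    using z0(1) by (auto simp: analytic_on_def)
  have "isCont (deriv f) z0"
    using z0(1) by (intro analytic_at_imp_isCont analytic_intros)
  then have "\<forall>\<^sub>F z in nhds z0. deriv f z \<noteq> 0"
    using z0(2) by (intro tendsto_imp_eventually_ne) (auto simp: isCont_def tendsto_at_iff_tendsto_nhds)
  then obtain r2 where r2: "r2 > 0" "\<And>z. z \<in> ball z0 r2 \<Longrightarrow> deriv f z \<noteq> 0"
    by (auto simp: eventually_nhds_metric dist_commute)
  define r where "r = min r1 r2"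
  have r: "r > 0" "f holomorphic_on ball z0 r" "\<And>z. z \<in> ball z0 r \<Longrightarrow> deriv f z \<noteq> 0"
    using r1 r2 by (auto simp: r_def intro: holomorphic_on_subset)
  have an: "schwarzian f analytic_on {z}" if "z \<in> ball z0 r" for z
    using that r by (intro schwarzian_analytic) (auto simp: analytic_at)
  have pow: "schwarzian f z ^ p = k" if "z \<in> ball z0 r" for z
  proof -
    have "(\<lambda>w. schwarzian f w ^ p) \<midarrow>z\<rightarrow> schwarzian f z ^ p"
      using an[OF that] by (intro tendsto_intros isContD analytic_at_imp_isCont)
    moreover have "\<forall>\<^sub>F w in at z. schwarzian f w ^ p = k"
      using S by (simp add: eventually_cosparse_open_eq)
    ultimately have "(\<lambda>_. k) \<midarrow>z\<rightarrow> schwarzian f z ^ p"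
      by (rule Lim_transform_eventually)
    then show ?thesis
      using LIM_const_eq by metis
  qed
  have "finite {x :: complex. poly (monom 1 p - [:k:]) x = 0}"
  proof (rule poly_roots_finite)
    have "coeff (monom 1 p - [:k:]) p = 1"
      using p by (simp add: coeff_eq_0)
    then show "monom 1 p - [:k:] \<noteq> 0"
      by (metis coeff_0 zero_neq_one)
  qed
  then have "finite (schwarzian f ` ball z0 r)"
    by (rule rev_finite_subset) (auto simp: poly_monom pow)
  moreover have "continuous_on (ball z0 r) (schwarzian f)"
    using an by (intro continuous_at_imp_continuous_on ballI analytic_at_imp_isCont)
  ultimately obtain c where "\<And>z. z \<in> ball z0 r \<Longrightarrow> schwarzian f z = c"
    using continuous_finite_range_constant[OF connected_ball, of z0 r "schwarzian f"]
    by (auto simp: constant_on_def)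
  with r pow[of z0] show thesis
    by (intro that[of r z0 c]) auto
qed

text \<open>
  The identity theorem extends the local statement \<open>schwarzian_eq_imp_moebius\<close>, including the poles.
\<close>

lemma schwarzian_eq_locally_imp_moebius:
  assumes f: "f nicely_meromorphic_on UNIV" "f holomorphic_on ball z0 r" "r > 0"
      "\<And>z. z \<in> ball z0 r \<Longrightarrow> deriv f z \<noteq> 0"
    and h: "h holomorphic_on UNIV" "\<And>z. deriv h z \<noteq> 0"
    and S: "\<And>z. z \<in> ball z0 r \<Longrightarrow> schwarzian f z = schwarzian h z"
  shows "\<exists>a b c d. a * d - b * c \<noteq> 0 \<and> to_sphere f = moebius a b c d \<circ> (Some \<circ> h)"
proof -
  have "\<exists>a b c d. a * d - b * c \<noteq> 0 \<and>
      (\<forall>z\<in>ball z0 r. c * h z + d \<noteq> 0 \<and> f z = (a * h z + b) / (c * h z + d))"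
    using f h S by (intro schwarzian_eq_imp_moebius) (auto intro: holomorphic_on_subset)
  then obtain a b c d where det: "a * d - b * c \<noteq> 0"
    and eq: "\<And>z. z \<in> ball z0 r \<Longrightarrow> c * h z + d \<noteq> 0 \<and> f z = (a * h z + b) / (c * h z + d)"
    by blast
  have "\<not> h constant_on UNIV"
  proof
    assume "h constant_on UNIV"
    then obtain k where "h = (\<lambda>_. k)"
      by (auto simp: constant_on_def)
    with h(2)[of 0] show False
      by simp
  qed
  then obtain g where g: "g nicely_meromorphic_on UNIV" "to_sphere g = moebius a b c d \<circ> to_sphere h"
    using moebius_of_meromorphic[OF entire_nicely_meromorphic[OF h(1)] _ det] by blast
  have "f z = g z" if "z \<in> ball z0 r" for z
    using eq[OF that] nicely_meromorphic_eq_to_sphere[OF g(1), of z]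
    by (simp add: g(2) to_sphere_entire[OF h(1)] moebius_def)
  then have "f = g"
    using nicely_meromorphic_eqI[OF f(1) g(1) _ f(3)] by blast
  then show ?thesis
    using det g(2) to_sphere_entire[OF h(1)] by metis
qed

section \<open>Autonomous Schwarzian equations with a locally injective solution\<close>

theorem theorem2:
  fixes p :: nat and P Q :: "complex poly"
  assumes "p \<ge> 1"
    and "Q \<noteq> 0"
    and "coprime P Q"
    and "\<exists>f. schwarzian_solution p P Q f \<and> locally_injective f \<and> transcendental f"
  shows "\<exists>\<gamma>\<^sub>1 c. is_moebius \<gamma>\<^sub>1 \<and> c \<noteq> 0 \<and> reduces_to p P Q \<gamma>\<^sub>1 [:c:] 1 \<and>
           (\<forall>sqr :: complex \<Rightarrow> complex. (\<forall>w. (sqr w)\<^sup>2 = w) \<longrightarrow>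
              to_sphere ` {f. schwarzian_solution p P Q f} =
              {\<lambda>z. \<gamma> (Some (exp (sqr (- 2 * c') * z))) | c' \<gamma>. c' ^ p = c ^ p \<and> is_moebius \<gamma>})"
proof -
  obtain f where f: "schwarzian_solution p P Q f" "locally_injective f" "transcendental f"
    using assms(4) by blast
  obtain k l where kl: "P = [:k:]" "Q = [:l:]" "l \<noteq> 0"
    using rat_map_no_pole_imp_constant[OF assms(2)]
      locally_injective_solution_no_coefficient_pole[OF assms(1-3) f(1,2)] by metis
  have solution_iff: "schwarzian_solution p P Q g \<longleftrightarrow>
      g nicely_meromorphic_on UNIV \<and> \<not> g constant_on UNIV \<and> (\<forall>\<^sub>\<approx>z. schwarzian g z ^ p = k / l)" for g
    by (simp add: schwarzian_solution_def kl)
  obtain z0 r c where c: "r > 0" "f holomorphic_on ball z0 r" "c ^ p = k / l"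
    "\<And>z. z \<in> ball z0 r \<Longrightarrow> deriv f z \<noteq> 0" "\<And>z. z \<in> ball z0 r \<Longrightarrow> schwarzian f z = c"
    using schwarzian_power_const_local[of f p "k / l"] f(1) assms(1) unfolding solution_iff by metis
  \<comment> \<open>The identity has Schwarzian 0, so \<open>c = 0\<close> would make \<open>f\<close> a Moebius map of \<open>z\<close>, which is rational.\<close>
  have "c \<noteq> 0"
  proof
    assume "c = 0"
    then obtain a b c d where det: "a * d - b * c \<noteq> 0" and eq: "to_sphere f = moebius a b c d \<circ> (Some \<circ> (\<lambda>z. z))"
      using schwarzian_eq_locally_imp_moebius[of f z0 r "\<lambda>z. z"] c f(1)
      by (auto simp: solution_iff schwarzian_ident)
    have "coprime [:b, a:] [:d, c:]"
    proof (rule coprimeI)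
      fix e assume e: "e dvd [:b, a:]" "e dvd [:d, c:]"
      have "smult d [:b, a:] - smult b [:d, c:] = [:0, a * d - b * c:]"
        "smult a [:d, c:] - smult c [:b, a:] = [:a * d - b * c:]"
        by (simp_all add: algebra_simps)
      then have "e dvd [:a * d - b * c:]"
        using e by (metis dvd_diff dvd_smult)
      moreover have "is_unit [:a * d - b * c:]"
        using det by (simp add: is_unit_const_poly_iff dvd_field_iff)
      ultimately show "is_unit e"
        using dvd_trans by blast
    qed
    moreover have "[:d, c:] \<noteq> 0"
      using det by auto
    moreover have "to_sphere f z = rat_map [:b, a:] [:d, c:] (Some z)" for z
      by (simp add: eq moebius_def rat_map_def algebra_simps)
    ultimately show False
      using f(3) unfolding transcendental_def by blast
  qed
  have nz: "c' \<noteq> 0" if "c' ^ p = c ^ p" for c'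
    using that \<open>c \<noteq> 0\<close> assms(1) by (metis power_0_left not_one_le_zero power_eq_0_iff)
  have "to_sphere ` {f. schwarzian_solution p P Q f} =
      {\<lambda>z. \<gamma> (Some (exp (sqr (- 2 * c') * z))) | c' \<gamma>. c' ^ p = c ^ p \<and> is_moebius \<gamma>}" (is "?L = ?R")
    if sqr: "\<And>w. (sqr w)\<^sup>2 = w" for sqr :: "complex \<Rightarrow> complex"
  proof -
    define h where "h = (\<lambda>c' z. exp (sqr (- 2 * c') * z))"
    have hol: "h c' holomorphic_on UNIV" for c'
      unfolding h_def by (intro holomorphic_intros)
    have h: "deriv (h c') z \<noteq> 0" "schwarzian (h c') z = c'" if "c' ^ p = c ^ p" for c' z
    proof -
      have s: "sqr (- 2 * c') \<noteq> 0"
        using sqr[of "- 2 * c'"] nz[OF that] by auto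
      have "(h c' has_field_derivative exp (sqr (- 2 * c') * z) * sqr (- 2 * c')) (at z)"
        unfolding h_def by (auto intro!: derivative_eq_intros)
      then show "deriv (h c') z \<noteq> 0"
        using s by (simp add: DERIV_imp_deriv)
      show "schwarzian (h c') z = c'"
        unfolding h_def schwarzian_exp_mult[OF s] sqr by simp
    qed
    show ?thesis
    proof
      show "?L \<subseteq> ?R"
      proof clarify
        fix g assume g: "schwarzian_solution p P Q g"
        obtain z1 r1 c' where c': "r1 > 0" "g holomorphic_on ball z1 r1" "c' ^ p = k / l"
          "\<And>z. z \<in> ball z1 r1 \<Longrightarrow> deriv g z \<noteq> 0" "\<And>z. z \<in> ball z1 r1 \<Longrightarrow> schwarzian g z = c'"
          using schwarzian_power_const_local[of g p "k / l"] g assms(1) unfolding solution_iff by metis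
        have "c' ^ p = c ^ p"
          using c(3) c'(3) by simp
        then obtain a b c1 d where "a * d - b * c1 \<noteq> 0" "to_sphere g = moebius a b c1 d \<circ> (Some \<circ> h c')"
          using schwarzian_eq_locally_imp_moebius[of g z1 r1 "h c'"] c' g hol h
          by (auto simp: solution_iff)
        moreover from this have "is_moebius (moebius a b c1 d)"
          by (auto simp: is_moebius_def)
        ultimately show "\<exists>c' \<gamma>. to_sphere g = (\<lambda>z. \<gamma> (Some (exp (sqr (- 2 * c') * z)))) \<and>
            c' ^ p = c ^ p \<and> is_moebius \<gamma>"
          using \<open>c' ^ p = c ^ p\<close> by (intro exI[of _ c'] exI[of _ "moebius a b c1 d"]) (auto simp: h_def)
      qed
    next
      show "?R \<subseteq> ?L"
      proof clarify
        fix c' \<gamma> assume c': "c' ^ p = c ^ p" and "is_moebius \<gamma>"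
        then obtain a b c1 d where det: "a * d - b * c1 \<noteq> 0" and \<gamma>: "\<gamma> = moebius a b c1 d"
          by (auto simp: is_moebius_def)
        have "\<not> h c' constant_on UNIV"
        proof
          assume "h c' constant_on UNIV"
          then obtain y where "h c' = (\<lambda>_. y)"
            by (auto simp: constant_on_def)
          with h(1)[OF c', of 0] show False
            by simp
        qed
        from moebius_of_meromorphic[OF entire_nicely_meromorphic[OF hol] this det]
        obtain g where g: "g nicely_meromorphic_on UNIV" "\<not> g constant_on UNIV"
          "to_sphere g = moebius a b c1 d \<circ> to_sphere (h c')"
          "\<forall>\<^sub>\<approx>z. schwarzian g z = schwarzian (h c') z"
          by metis
        have "\<forall>\<^sub>\<approx>z. schwarzian g z ^ p = k / l"
          using g(4) by eventually_elim (simp add: h(2)[OF c'] c' c(3))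
        then have "schwarzian_solution p P Q g"
          using g(1,2) by (simp add: solution_iff)
        moreover have "to_sphere g = (\<lambda>z. \<gamma> (Some (exp (sqr (- 2 * c') * z))))"
          unfolding g(3) to_sphere_entire[OF hol] \<gamma> by (auto simp: h_def)
        ultimately show "(\<lambda>z. \<gamma> (Some (exp (sqr (- 2 * c') * z)))) \<in> ?L"
          by (metis (mono_tags) image_eqI mem_Collect_eq)
      qed
    qed
  qed
  \<comment> \<open>Since \<open>P/Q\<close> is constant, the identity serves as the substitution.\<close>
  moreover have "reduces_to p P Q (moebius 1 0 0 1) [:c:] 1"
  proof -
    have "moebius 1 0 0 1 w = w" for w
      by (simp add: moebius_def split: option.splits)
    then show ?thesis
      using kl c(3) by (auto simp: reduces_to_def rat_map_def fun_eq_iff poly_const_pow split: option.splits)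
  qed
  moreover have "is_moebius (moebius 1 0 0 1)"
    unfolding is_moebius_def by (intro exI[of _ 1] exI[of _ 0]) auto
  ultimately show ?thesis
    using \<open>c \<noteq> 0\<close> by blast
qed

end
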